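(* Let $A$ be a Banach algebra with a central approximate identity. Then $A$ is Johnson pseudo-contractible if and only if $A$ has property $\digamma$.
   Context: A central approximate identity of $A$ is a (not necessarily bounded) net $(e_\beta)$ in $A$ with $ae_\beta=e_\beta a$ for all $a\in A$ and all $\beta$, and $e_\beta a\to a$ in norm for every $a\in A$. For a Banach algebra $A$, let $A\otimes_p A$ be the (completed) projective tensor product, a Banach $A$-bimodule with actions determined by $a\cdot(b\otimes c)=ab\otimes c$ and $(b\otimes c)\cdot a=b\otimes ca$, and let $\pi_A:A\otimes_p A\to A$ be the bounded linear map determined by $\pi_A(a\otimes b)=ab$. The biduals $A^{**}$ and $(A\otimes_p A)^{**}$ carry the induced bidual $A$-bimodule structures, and $A$ is regarded as canonically embedded in $A^{**}$. $A$ is Johnson pseudo-contractible if there is a (not necessarily bounded) net $(m_\alpha)$ in $(A\otimes_p A)^{**}$ such that $a\cdot m_\alpha=m_\alpha\cdot a$ for all $\alpha$ and $\pi_A^{**}(m_\alpha)a-a\to 0$ in norm, for every $a\in A$. $A$ has property $\digamma$ if there is a (not necessarily bounded) net $(\rho_\alpha)$ of bounded linear $A$-bimodule morphisms $\rho_\alpha:A\to(A\otimes_p A)^{**}$ such that $\pi_A^{**}\circ\rho_\alpha(a)-a\to 0$ in norm for every $a\in A$. *)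

theory Defs
  imports "HOL-Analysis.Analysis" "HOL-Library.Poly_Mapping"
begin

section \<open>Complex Banach algebras\<close>

class complex_normed_vector = real_normed_vector +
  fixes scaleC :: "complex \<Rightarrow> 'a \<Rightarrow> 'a" (infixr \<open>*\<^sub>C\<close> 75)
  assumes scaleC_add_right: "c *\<^sub>C (x + y) = c *\<^sub>C x + c *\<^sub>C y"
    and scaleC_add_left: "(c + d) *\<^sub>C x = c *\<^sub>C x + d *\<^sub>C x"
    and scaleC_scaleC: "c *\<^sub>C d *\<^sub>C x = (c * d) *\<^sub>C x"
    and scaleR_scaleC: "r *\<^sub>R x = complex_of_real r *\<^sub>C x"
    and norm_scaleC: "norm (c *\<^sub>C x) = cmod c * norm x"

text \<open>Algebras are not assumed to be unital.\<close>

class complex_banach_algebra = complex_normed_vector + real_normed_algebra + banach +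
  assumes mult_scaleC_left: "(c *\<^sub>C x) * y = c *\<^sub>C (x * y)"
    and mult_scaleC_right: "x * (c *\<^sub>C y) = c *\<^sub>C (x * y)"

lemma scaleC_one: "1 *\<^sub>C x = (x :: 'a::complex_normed_vector)"
  using scaleR_scaleC[of 1 x] by simp

lemma scaleC_zero_left: "0 *\<^sub>C x = (0 :: 'a::complex_normed_vector)"
  using scaleR_scaleC[of 0 x] by simp

lemma scaleC_zero_right: "c *\<^sub>C 0 = (0 :: 'a::complex_normed_vector)"
  using scaleC_add_right[of c 0 0] by simp

lemma scaleC_minus_right: "c *\<^sub>C (- x) = - (c *\<^sub>C (x :: 'a::complex_normed_vector))"
  using scaleC_add_right[of c x "- x"] by (simp add: scaleC_zero_right eq_neg_iff_add_eq_0 add.commute)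

lemma scaleC_diff_right: "c *\<^sub>C (x - y) = c *\<^sub>C x - c *\<^sub>C (y :: 'a::complex_normed_vector)"
  using scaleC_add_right[of c x "- y"] by (simp add: scaleC_minus_right)

lemma scaleC_minus_one: "(- 1) *\<^sub>C x = - (x :: 'a::complex_normed_vector)"
  using scaleR_scaleC[of "-1" x] by simp

lemma scaleC_sum_right: "c *\<^sub>C (\<Sum>k\<in>S. f k) = (\<Sum>k\<in>S. c *\<^sub>C (f k :: 'a::complex_normed_vector))"
  by (induction S rule: infinite_finite_induct) (auto simp: scaleC_zero_right scaleC_add_right)

lemma bounded_linear_scaleC: "bounded_linear (\<lambda>x. c *\<^sub>C (x :: 'a::complex_normed_vector))"
  by (rule bounded_linear_intro[where K = "cmod c"])
     (auto simp: scaleC_add_right scaleR_scaleC scaleC_scaleC norm_scaleC mult.commute)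

instantiation complex :: complex_banach_algebra
begin
definition scaleC_complex :: "complex \<Rightarrow> complex \<Rightarrow> complex" where "scaleC_complex c x = c * x"
instance
  by standard (auto simp: scaleC_complex_def algebra_simps norm_mult scaleR_conv_of_real)
end

definition bounded_clinear :: "('a::complex_normed_vector \<Rightarrow> 'b::complex_normed_vector) \<Rightarrow> bool" where
  "bounded_clinear f \<longleftrightarrow> bounded_linear f \<and> (\<forall>c x. f (c *\<^sub>C x) = c *\<^sub>C f x)"

definition bounded_cbilinear ::
  "('a::complex_normed_vector \<Rightarrow> 'b::complex_normed_vector \<Rightarrow> 'c::complex_normed_vector) \<Rightarrow> bool" where
  "bounded_cbilinear \<phi> \<longleftrightarrow> bounded_bilinear \<phi> \<and>
    (\<forall>c x y. \<phi> (c *\<^sub>C x) y = c *\<^sub>C \<phi> x y) \<and> (\<forall>c x y. \<phi> x (c *\<^sub>C y) = c *\<^sub>C \<phi> x y)"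


section \<open>The dual space\<close>

text \<open>The norm is the operator norm, inherited from the library type of bounded real-linear maps.\<close>

typedef (overloaded) 'a cdual =
  "{f :: 'a::complex_normed_vector \<Rightarrow>\<^sub>L complex. \<forall>c x. f (c *\<^sub>C x) = c * f x}"
  by (rule exI[of _ 0]) auto

setup_lifting type_definition_cdual

lift_definition cdual_apply :: "'a::complex_normed_vector cdual \<Rightarrow> 'a \<Rightarrow> complex"
  is blinfun_apply .

lift_definition Cdual :: "('a::complex_normed_vector \<Rightarrow> complex) \<Rightarrow> 'a cdual"
  is "\<lambda>f. if bounded_clinear f then Blinfun f else 0"
  by (auto simp: bounded_clinear_def bounded_linear_Blinfun_apply scaleC_complex_def)

instantiation cdual :: (complex_normed_vector) complex_normed_vector
begin
lift_definition zero_cdual :: "'a cdual" is 0 by simp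
lift_definition plus_cdual :: "'a cdual \<Rightarrow> 'a cdual \<Rightarrow> 'a cdual" is "(+)"
  by (simp add: blinfun.add_left algebra_simps)
lift_definition minus_cdual :: "'a cdual \<Rightarrow> 'a cdual \<Rightarrow> 'a cdual" is "(-)"
  by (simp add: blinfun.diff_left algebra_simps)
lift_definition uminus_cdual :: "'a cdual \<Rightarrow> 'a cdual" is uminus
  by (simp add: blinfun.minus_left)
lift_definition scaleR_cdual :: "real \<Rightarrow> 'a cdual \<Rightarrow> 'a cdual" is scaleR
  by (simp add: blinfun.scaleR_left)
lift_definition norm_cdual :: "'a cdual \<Rightarrow> real" is norm .
lift_definition scaleC_cdual :: "complex \<Rightarrow> 'a cdual \<Rightarrow> 'a cdual"
  is "\<lambda>c f. blinfun_compose (Blinfun ((*) c)) f"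
  by (simp add: bounded_linear_Blinfun_apply bounded_linear_mult_right)
definition dist_cdual :: "'a cdual \<Rightarrow> 'a cdual \<Rightarrow> real" where "dist_cdual f g = norm (f - g)"
definition sgn_cdual :: "'a cdual \<Rightarrow> 'a cdual" where "sgn_cdual f = scaleR (inverse (norm f)) f"
definition uniformity_cdual :: "('a cdual \<times> 'a cdual) filter" where
  "uniformity_cdual = (INF e\<in>{0<..}. principal {(x, y). dist x y < e})"
definition open_cdual :: "'a cdual set \<Rightarrow> bool" where
  "open_cdual U \<longleftrightarrow> (\<forall>x\<in>U. \<forall>\<^sub>F (x', y) in uniformity. x' = x \<longrightarrow> y \<in> U)"

lemma Blinfun_cmult: "blinfun_apply (Blinfun ((*) (c::complex))) = (*) c"
  by (simp add: bounded_linear_Blinfun_apply bounded_linear_mult_right)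

lemma norm_cmult_blinfun:
  "norm (blinfun_compose (Blinfun ((*) (c::complex))) f) = cmod c * norm f"
proof (cases "c = 0")
  case True
  have "blinfun_compose (Blinfun ((*) c)) f = 0"
    by (rule blinfun_eqI) (simp add: Blinfun_cmult True)
  then show ?thesis using True by simp
next
  case False
  have le: "norm (blinfun_compose (Blinfun ((*) d)) g) \<le> cmod d * norm g"
    for d and g :: "'b::real_normed_vector \<Rightarrow>\<^sub>L complex"
  proof (rule norm_blinfun_bound)
    fix x
    have "cmod d * cmod (g x) \<le> cmod d * (norm g * norm x)"
      by (intro mult_left_mono norm_blinfun) auto
    then show "norm (blinfun_apply (blinfun_compose (Blinfun ((*) d)) g) x) \<le> cmod d * norm g * norm x"
      by (simp add: Blinfun_cmult norm_mult mult.assoc)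
  qed auto
  have "blinfun_compose (Blinfun ((*) (inverse c))) (blinfun_compose (Blinfun ((*) c)) f) = f"
    by (rule blinfun_eqI) (simp add: Blinfun_cmult False)
  then have "norm f \<le> cmod (inverse c) * norm (blinfun_compose (Blinfun ((*) c)) f)"
    using le[of "inverse c" "blinfun_compose (Blinfun ((*) c)) f"] by simp
  then have "cmod c * norm f \<le> norm (blinfun_compose (Blinfun ((*) c)) f)"
    using False by (simp add: norm_divide norm_inverse field_simps)
  then show ?thesis using le[of c f] by linarith
qed

instance
proof
  fix f g h :: "'a cdual" and r s :: real and c d :: complex
  show "f + g + h = f + (g + h)" by transfer simp
  show "f + g = g + f" by transfer simp
  show "0 + f = f" by transfer simp
  show "- f + f = 0" by transfer simp
  show "f - g = f + - g" by transfer simp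
  show "r *\<^sub>R (f + g) = r *\<^sub>R f + r *\<^sub>R g" by transfer (simp add: algebra_simps)
  show "(r + s) *\<^sub>R f = r *\<^sub>R f + s *\<^sub>R f" by transfer (simp add: algebra_simps)
  show "r *\<^sub>R s *\<^sub>R f = (r * s) *\<^sub>R f" by transfer simp
  show "1 *\<^sub>R f = f" by transfer simp
  show "norm f = 0 \<longleftrightarrow> f = 0" by transfer simp
  show "norm (f + g) \<le> norm f + norm g" by transfer (rule norm_triangle_ineq)
  show "norm (r *\<^sub>R f) = \<bar>r\<bar> * norm f" by transfer simp
  show "c *\<^sub>C (f + g) = c *\<^sub>C f + c *\<^sub>C g"
    by transfer (rule blinfun_eqI, simp add: Blinfun_cmult blinfun.add_left algebra_simps)
  show "(c + d) *\<^sub>C f = c *\<^sub>C f + d *\<^sub>C f"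
    by transfer (rule blinfun_eqI, simp add: Blinfun_cmult blinfun.add_left algebra_simps)
  show "c *\<^sub>C d *\<^sub>C f = (c * d) *\<^sub>C f"
    by transfer (rule blinfun_eqI, simp add: Blinfun_cmult)
  show "r *\<^sub>R f = complex_of_real r *\<^sub>C f"
    by transfer (rule blinfun_eqI, simp add: Blinfun_cmult blinfun.scaleR_left scaleR_conv_of_real)
  show "norm (c *\<^sub>C f) = cmod c * norm f" by transfer (rule norm_cmult_blinfun)
  show "dist f g = norm (f - g)" by (rule dist_cdual_def)
  show "sgn f = scaleR (inverse (norm f)) f" by (rule sgn_cdual_def)
  show "(uniformity :: ('a cdual \<times> 'a cdual) filter) = (INF e\<in>{0<..}. principal {(x, y). dist x y < e})"
    by (rule uniformity_cdual_def)
  show "open U \<longleftrightarrow> (\<forall>x\<in>U. \<forall>\<^sub>F (x', y) in uniformity. x' = x \<longrightarrow> y \<in> U)" for U :: "'a cdual set"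
    by (rule open_cdual_def)
qed
end

lemma bounded_clinear_cdual_apply: "bounded_clinear (cdual_apply f)"
  unfolding bounded_clinear_def scaleC_complex_def
  by transfer (auto simp: blinfun.bounded_linear_right)

lemma cdual_apply_Cdual: "bounded_clinear f \<Longrightarrow> cdual_apply (Cdual f) = f"
  by transfer (simp add: bounded_clinear_def bounded_linear_Blinfun_apply)

lemma cdual_eqI: "(\<And>x. cdual_apply f x = cdual_apply g x) \<Longrightarrow> f = g"
  by transfer (rule blinfun_eqI)

lemma cdual_apply_simps:
  "cdual_apply 0 x = 0"
  "cdual_apply (f + g) x = cdual_apply f x + cdual_apply g x"
  "cdual_apply (f - g) x = cdual_apply f x - cdual_apply g x"
  "cdual_apply (- f) x = - cdual_apply f x"
  "cdual_apply (c *\<^sub>C f) x = c * cdual_apply f x"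
  by (transfer, simp add: Blinfun_cmult blinfun.bilinear_simps)+

lemma norm_cdual_eq: "norm f = onorm (cdual_apply f)"
  by transfer (rule norm_blinfun.rep_eq)

lemma norm_cdual_apply_le: "cmod (cdual_apply f x) \<le> norm f * norm x"
  by transfer (rule norm_blinfun)

lemma norm_cdual_le:
  assumes "0 \<le> K" "\<And>x. cmod (cdual_apply f x) \<le> K * norm x"
  shows "norm f \<le> K"
  using assms by transfer (rule norm_blinfun_bound)


section \<open>The algebraic tensor product\<close>

type_synonym ('a, 'b) free = "('a \<times> 'b) \<Rightarrow>\<^sub>0 complex"

definition free_scale :: "complex \<Rightarrow> ('a, 'b) free \<Rightarrow> ('a, 'b) free" where
  "free_scale c = Poly_Mapping.map ((*) c)"

lemma lookup_free_scale [simp]: "Poly_Mapping.lookup (free_scale c u) k = c * Poly_Mapping.lookup u k"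
  unfolding free_scale_def by transfer (auto simp: when_def)

interpretation free: vector_space free_scale
  by unfold_locales (rule poly_mapping_eqI, simp add: lookup_add algebra_simps)+

definition tensor_relators :: "('a::complex_normed_vector, 'b::complex_normed_vector) free set" where
  "tensor_relators =
    {Poly_Mapping.single (x + x', y) 1 - Poly_Mapping.single (x, y) 1 - Poly_Mapping.single (x', y) 1 |x x' y. True} \<union>
    {Poly_Mapping.single (x, y + y') 1 - Poly_Mapping.single (x, y) 1 - Poly_Mapping.single (x, y') 1 |x y y'. True} \<union>
    {Poly_Mapping.single (c *\<^sub>C x, y) 1 - Poly_Mapping.single (x, y) c |c x y. True} \<union>
    {Poly_Mapping.single (x, c *\<^sub>C y) 1 - Poly_Mapping.single (x, y) c |c x y. True}"

quotient_type (overloaded) ('a, 'b) atensor =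
  "('a::complex_normed_vector, 'b::complex_normed_vector) free" /
  "\<lambda>u v. u - v \<in> free.span tensor_relators"
proof (rule equivpI)
  show "reflp (\<lambda>u v. u - v \<in> free.span (tensor_relators :: ('a, 'b) free set))"
    by (simp add: reflp_def free.span_zero)
  show "symp (\<lambda>u v. u - v \<in> free.span (tensor_relators :: ('a, 'b) free set))"
    by (rule sympI) (drule free.span_neg, simp)
  show "transp (\<lambda>u v. u - v \<in> free.span (tensor_relators :: ('a, 'b) free set))"
    by (rule transpI) (drule (1) free.span_add, simp)
qed

instantiation atensor :: (complex_normed_vector, complex_normed_vector) ab_group_add
begin
lift_definition zero_atensor :: "('a, 'b) atensor" is 0 .
lift_definition plus_atensor :: "('a, 'b) atensor \<Rightarrow> ('a, 'b) atensor \<Rightarrow> ('a, 'b) atensor" is "(+)"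
  by (drule (1) free.span_add) (simp add: algebra_simps)
lift_definition uminus_atensor :: "('a, 'b) atensor \<Rightarrow> ('a, 'b) atensor" is uminus
  by (drule free.span_neg) (simp add: algebra_simps)
lift_definition minus_atensor :: "('a, 'b) atensor \<Rightarrow> ('a, 'b) atensor \<Rightarrow> ('a, 'b) atensor" is "(-)"
  by (drule (1) free.span_diff) (simp add: algebra_simps)
instance
  by standard (transfer, simp add: algebra_simps free.span_zero)+
end

lift_definition atensor_scale ::
  "complex \<Rightarrow> ('a::complex_normed_vector, 'b::complex_normed_vector) atensor \<Rightarrow> ('a, 'b) atensor"
  is free_scale
  by (simp add: free.span_scale flip: free.scale_right_diff_distrib)

lift_definition atensor :: "'a::complex_normed_vector \<Rightarrow> 'b::complex_normed_vector \<Rightarrow> ('a, 'b) atensor"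
  is "\<lambda>x y. Poly_Mapping.single (x, y) 1" .

interpretation atensor: vector_space atensor_scale
  by unfold_locales (transfer, simp add: free.scale_right_distrib free.scale_left_distrib free.span_zero)+

lemma atensor_scaleC_left: "atensor (c *\<^sub>C x) y = atensor_scale c (atensor x y)"
proof transfer
  fix c and x :: 'a and y :: 'b
  have "free_scale c (Poly_Mapping.single (x, y) 1) = Poly_Mapping.single (x, y) c"
    by (rule poly_mapping_eqI) (simp add: lookup_single when_def)
  then show "Poly_Mapping.single (c *\<^sub>C x, y) 1 - free_scale c (Poly_Mapping.single (x, y) 1)
      \<in> free.span tensor_relators"
    by (simp only:) (rule free.span_base, unfold tensor_relators_def, blast)
qed

lemma atensor_scaleC_right: "atensor x (c *\<^sub>C y) = atensor_scale c (atensor x y)"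
proof transfer
  fix c and x :: 'a and y :: 'b
  have "free_scale c (Poly_Mapping.single (x, y) 1) = Poly_Mapping.single (x, y) c"
    by (rule poly_mapping_eqI) (simp add: lookup_single when_def)
  then show "Poly_Mapping.single (x, c *\<^sub>C y) 1 - free_scale c (Poly_Mapping.single (x, y) 1)
      \<in> free.span tensor_relators"
    by (simp only:) (rule free.span_base, unfold tensor_relators_def, blast)
qed

lemma atensor_add_left: "atensor (x + x') y = atensor x y + atensor x' y"
proof transfer
  fix x x' :: 'a and y :: 'b
  have "Poly_Mapping.single (x + x', y) 1 - Poly_Mapping.single (x, y) 1 - Poly_Mapping.single (x', y) 1
      \<in> free.span tensor_relators"
    by (rule free.span_base, unfold tensor_relators_def, blast)
  then show "Poly_Mapping.single (x + x', y) 1 - (Poly_Mapping.single (x, y) 1 + Poly_Mapping.single (x', y) 1)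
      \<in> free.span tensor_relators"
    by (simp only: diff_diff_add)
qed

lemma atensor_add_right: "atensor x (y + y') = atensor x y + atensor x y'"
proof transfer
  fix x :: 'a and y y' :: 'b
  have "Poly_Mapping.single (x, y + y') 1 - Poly_Mapping.single (x, y) 1 - Poly_Mapping.single (x, y') 1
      \<in> free.span tensor_relators"
    by (rule free.span_base, unfold tensor_relators_def, blast)
  then show "Poly_Mapping.single (x, y + y') 1 - (Poly_Mapping.single (x, y) 1 + Poly_Mapping.single (x, y') 1)
      \<in> free.span tensor_relators"
    by (simp only: diff_diff_add)
qed

lemma atensor_repr: "\<exists>xs. t = (\<Sum>(x, y)\<leftarrow>xs. atensor x y)"
proof -
  have scale: "\<exists>ys. atensor_scale c (\<Sum>(x, y)\<leftarrow>xs. atensor x y) = (\<Sum>(x, y)\<leftarrow>ys. atensor x y)"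
    for c and xs :: "('a \<times> 'b) list"
    by (rule exI[of _ "map (\<lambda>(x, y). (c *\<^sub>C x, y)) xs"], induction xs)
       (auto simp: atensor.scale_right_distrib atensor_scaleC_left)
  have add: "\<exists>zs. (\<Sum>(x, y)\<leftarrow>xs. atensor x y) + (\<Sum>(x, y)\<leftarrow>ys. atensor x y) = (\<Sum>(x, y)\<leftarrow>zs. atensor x y)"
    for xs ys :: "('a \<times> 'b) list"
    by (rule exI[of _ "xs @ ys"]) simp
  obtain u where u: "t = abs_atensor u"
    by (metis Quotient_abs_rep[OF Quotient_atensor])
  have "\<exists>xs. abs_atensor u = (\<Sum>(x, y)\<leftarrow>xs. atensor x y)"
  proof (induction u rule: update_induct)
    case const
    show ?case by (rule exI[of _ "[]"]) (simp add: zero_atensor.abs_eq)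
  next
    case (update f a b)
    obtain x y where a: "a = (x, y)" by force
    have "Poly_Mapping.update a b f = f + free_scale b (Poly_Mapping.single (x, y) 1)"
      using update(1) by (intro poly_mapping_eqI)
        (auto simp: lookup_update lookup_add lookup_single when_def a in_keys_iff)
    then have "abs_atensor (Poly_Mapping.update a b f) = abs_atensor f + atensor_scale b (atensor x y)"
      by (simp add: plus_atensor.abs_eq atensor_scale.abs_eq atensor.abs_eq)
    also have "atensor_scale b (atensor x y) = (\<Sum>(x, y)\<leftarrow>[(b *\<^sub>C x, y)]. atensor x y)"
      by (simp add: atensor_scaleC_left)
    finally show ?case using update(3) add by metis
  qed
  then show ?thesis by (simp add: u)
qed

text \<open>The linear map on the algebraic tensor product induced by a bilinear map.\<close>

definition free_ext :: "('a \<Rightarrow> 'b \<Rightarrow> 'c::complex_normed_vector) \<Rightarrow> ('a, 'b) free \<Rightarrow> 'c" where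
  "free_ext \<phi> u = (\<Sum>(x, y)\<in>Poly_Mapping.keys u. Poly_Mapping.lookup u (x, y) *\<^sub>C \<phi> x y)"

lemma free_ext_superset:
  assumes "finite S" "Poly_Mapping.keys u \<subseteq> S"
  shows "free_ext \<phi> u = (\<Sum>(x, y)\<in>S. Poly_Mapping.lookup u (x, y) *\<^sub>C \<phi> x y)"
  unfolding free_ext_def using assms
  by (intro sum.mono_neutral_left) (auto simp: in_keys_iff scaleC_zero_left)

lemma free_ext_add: "free_ext \<phi> (u + v) = free_ext \<phi> u + free_ext \<phi> v"
proof -
  have S: "finite (Poly_Mapping.keys u \<union> Poly_Mapping.keys v)" "Poly_Mapping.keys (u + v) \<subseteq> Poly_Mapping.keys u \<union> Poly_Mapping.keys v"
    by (auto simp: keys_add)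
  show ?thesis
    by (subst (1 2 3) free_ext_superset[OF S(1)])
       (use S(2) in \<open>auto simp: lookup_add scaleC_add_left sum.distrib split_beta\<close>)
qed

lemma free_ext_scale: "free_ext \<phi> (free_scale c u) = c *\<^sub>C free_ext \<phi> u"
proof -
  have "Poly_Mapping.keys (free_scale c u) \<subseteq> Poly_Mapping.keys u" by (auto simp: in_keys_iff)
  then show ?thesis
    by (subst free_ext_superset[of "Poly_Mapping.keys u"]) (auto simp: free_ext_def scaleC_sum_right scaleC_scaleC split_beta)
qed

lemma free_ext_diff: "free_ext \<phi> (u - v) = free_ext \<phi> u - free_ext \<phi> v"
  using free_ext_add[of \<phi> "u - v" v] by simp

lemma free_ext_single: "free_ext \<phi> (Poly_Mapping.single (x, y) c) = c *\<^sub>C \<phi> x y"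
  by (subst free_ext_superset[of "{(x, y)}"]) auto

lemma free_ext_relators:
  assumes "bounded_cbilinear \<phi>" "u \<in> free.span tensor_relators"
  shows "free_ext \<phi> u = 0"
  using assms(2)
proof (induction rule: free.span_induct_alt)
  case base
  show ?case by (simp add: free_ext_def)
next
  case (step c r v)
  interpret bounded_bilinear \<phi> using assms(1) by (simp add: bounded_cbilinear_def)
  have "free_ext \<phi> r = 0"
    using step(1) assms(1)
    by (auto simp: tensor_relators_def free_ext_diff free_ext_single scaleC_one add_left add_right
        bounded_cbilinear_def)
  with step show ?case by (simp add: free_ext_add free_ext_scale scaleC_zero_right)
qed

lift_definition atensor_ext ::
  "('a::complex_normed_vector \<Rightarrow> 'b::complex_normed_vector \<Rightarrow> 'c::complex_normed_vector)
    \<Rightarrow> ('a, 'b) atensor \<Rightarrow> 'c"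
  is "\<lambda>\<phi> u. if bounded_cbilinear \<phi> then free_ext \<phi> u else 0"
  by (auto dest: free_ext_relators simp: free_ext_diff)

lemma atensor_ext_add: "atensor_ext \<phi> (s + t) = atensor_ext \<phi> s + atensor_ext \<phi> t"
  by transfer (simp add: free_ext_add)

lemma atensor_ext_zero: "atensor_ext \<phi> 0 = 0"
  using atensor_ext_add[of \<phi> 0 0] by simp

lemma atensor_ext_diff: "atensor_ext \<phi> (s - t) = atensor_ext \<phi> s - atensor_ext \<phi> t"
  using atensor_ext_add[of \<phi> "s - t" t] by simp

lemma atensor_ext_scale: "atensor_ext \<phi> (atensor_scale c t) = c *\<^sub>C atensor_ext \<phi> t"
  by transfer (simp add: free_ext_scale scaleC_zero_right)

lemma atensor_ext_atensor: "bounded_cbilinear \<phi> \<Longrightarrow> atensor_ext \<phi> (atensor x y) = \<phi> x y"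
  by transfer (simp add: free_ext_single scaleC_one)


section \<open>The projective norm\<close>

definition pnorm :: "('a::complex_normed_vector, 'b::complex_normed_vector) atensor \<Rightarrow> real" where
  "pnorm t = Inf {(\<Sum>(x, y)\<leftarrow>xs. norm x * norm y) | xs. t = (\<Sum>(x, y)\<leftarrow>xs. atensor x y)}"

lemma weight_nonneg: "0 \<le> (\<Sum>(x, y)\<leftarrow>xs. norm x * norm y)"
  by (induction xs) auto

lemma pnorm_le: "pnorm (\<Sum>(x, y)\<leftarrow>xs. atensor x y) \<le> (\<Sum>(x, y)\<leftarrow>xs. norm x * norm y)"
  unfolding pnorm_def by (rule cInf_lower) (auto intro!: bdd_belowI[of _ 0] weight_nonneg)

lemma pnorm_greatest:
  assumes "\<And>xs. t = (\<Sum>(x, y)\<leftarrow>xs. atensor x y) \<Longrightarrow> K \<le> (\<Sum>(x, y)\<leftarrow>xs. norm x * norm y)"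
  shows "K \<le> pnorm t"
  unfolding pnorm_def by (rule cInf_greatest) (use assms atensor_repr[of t] in auto)

lemma pnorm_nonneg: "0 \<le> pnorm t"
  by (rule pnorm_greatest) (rule weight_nonneg)

lemma pnorm_zero: "pnorm 0 = 0"
  by (rule antisym) (use pnorm_le[of "[]"] in simp, rule pnorm_nonneg)

lemma pnorm_atensor_le: "pnorm (atensor x y) \<le> norm x * norm y"
  using pnorm_le[of "[(x, y)]"] by simp

lemma pnorm_triangle: "pnorm (s + t) \<le> pnorm s + pnorm t"
proof -
  have "pnorm (s + t) - pnorm t \<le> pnorm s"
  proof (rule pnorm_greatest)
    fix xs assume s: "s = (\<Sum>(x, y)\<leftarrow>xs. atensor x y)"
    have "pnorm (s + t) - (\<Sum>(x, y)\<leftarrow>xs. norm x * norm y) \<le> pnorm t"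
    proof (rule pnorm_greatest)
      fix ys assume t: "t = (\<Sum>(x, y)\<leftarrow>ys. atensor x y)"
      show "pnorm (s + t) - (\<Sum>(x, y)\<leftarrow>xs. norm x * norm y) \<le> (\<Sum>(x, y)\<leftarrow>ys. norm x * norm y)"
        using pnorm_le[of "xs @ ys"] by (simp add: s t)
    qed
    then show "pnorm (s + t) - pnorm t \<le> (\<Sum>(x, y)\<leftarrow>xs. norm x * norm y)" by linarith
  qed
  then show ?thesis by linarith
qed

lemma pnorm_scale_le: "pnorm (atensor_scale c t) \<le> cmod c * pnorm t"
proof (cases "c = 0")
  case True
  then show ?thesis by (simp add: pnorm_zero)
next
  case False
  have "pnorm (atensor_scale c t) / cmod c \<le> pnorm t"
  proof (rule pnorm_greatest)
    fix xs assume t: "t = (\<Sum>(x, y)\<leftarrow>xs. atensor x y)"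
    let ?ys = "map (\<lambda>(x, y). (c *\<^sub>C x, y)) xs"
    have "atensor_scale c t = (\<Sum>(x, y)\<leftarrow>?ys. atensor x y)"
      unfolding t by (induction xs) (auto simp: atensor.scale_right_distrib atensor_scaleC_left)
    moreover have "(\<Sum>(x, y)\<leftarrow>?ys. norm x * norm y) = cmod c * (\<Sum>(x, y)\<leftarrow>xs. norm x * norm y)"
      by (induction xs) (auto simp: norm_scaleC algebra_simps)
    ultimately show "pnorm (atensor_scale c t) / cmod c \<le> (\<Sum>(x, y)\<leftarrow>xs. norm x * norm y)"
      using pnorm_le[of ?ys] False by (simp add: field_simps)
  qed
  then show ?thesis using False by (simp add: field_simps)
qed

lemma pnorm_scale: "pnorm (atensor_scale c t) = cmod c * pnorm t"
proof (cases "c = 0")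
  case True
  then show ?thesis by (simp add: pnorm_zero)
next
  case False
  have "pnorm t \<le> cmod (inverse c) * pnorm (atensor_scale c t)"
    using pnorm_scale_le[of "inverse c" "atensor_scale c t"] False by simp
  then have "cmod c * pnorm t \<le> pnorm (atensor_scale c t)"
    using False by (simp add: norm_divide norm_inverse field_simps)
  then show ?thesis using pnorm_scale_le[of c t] by linarith
qed

lemma pnorm_minus: "pnorm (- t) = pnorm t"
  using pnorm_scale[of "-1" t] by simp

lemma pnorm_minus_commute: "pnorm (s - t) = pnorm (t - s)"
  using pnorm_minus[of "s - t"] by simp

lemma pnorm_triangle_diff: "\<bar>pnorm s - pnorm t\<bar> \<le> pnorm (s - t)"
  using pnorm_triangle[of "s - t" t] pnorm_triangle[of "t - s" s] pnorm_minus_commute[of s t]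
  by simp

lemma atensor_ext_bound:
  assumes "bounded_cbilinear \<phi>"
  obtains K where "K > 0" "\<And>t. norm (atensor_ext \<phi> t) \<le> K * pnorm t"
proof -
  interpret bounded_bilinear \<phi> using assms by (simp add: bounded_cbilinear_def)
  obtain K where K: "K > 0" "\<And>x y. norm (\<phi> x y) \<le> norm x * norm y * K"
    using pos_bounded by blast
  have "norm (atensor_ext \<phi> t) \<le> K * pnorm t" for t
  proof -
    have "norm (atensor_ext \<phi> t) / K \<le> pnorm t"
    proof (rule pnorm_greatest)
      fix xs assume t: "t = (\<Sum>(x, y)\<leftarrow>xs. atensor x y)"
      have "norm (atensor_ext \<phi> (\<Sum>(x, y)\<leftarrow>xs. atensor x y)) \<le> (\<Sum>(x, y)\<leftarrow>xs. norm x * norm y) * K"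
      proof (induction xs)
        case (Cons p xs)
        obtain x y where p: "p = (x, y)" by force
        show ?case
          using Cons K(2)[of x y] norm_triangle_ineq[of "\<phi> x y" "atensor_ext \<phi> (\<Sum>(x, y)\<leftarrow>xs. atensor x y)"]
          by (simp add: p atensor_ext_add atensor_ext_atensor[OF assms] algebra_simps)
      qed (simp add: atensor_ext_zero)
      then show "norm (atensor_ext \<phi> t) / K \<le> (\<Sum>(x, y)\<leftarrow>xs. norm x * norm y)"
        using K(1) by (simp add: t field_simps)
    qed
    then show ?thesis using K(1) by (simp add: field_simps)
  qed
  then show ?thesis using K(1) that by blast
qed


section \<open>The completed projective tensor product\<close>

text \<open>
  The completion of the algebraic tensor product with respect to \<open>pnorm\<close>, as classes of
  Cauchy sequences. It is a completion of a seminormed space, which identifies elements at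
  distance zero; as \<open>pnorm\<close> is in fact a norm (Hahn-Banach), the algebraic tensor product embeds.
\<close>

definition pcauchy ::
  "(nat \<Rightarrow> ('a::complex_normed_vector, 'b::complex_normed_vector) atensor) \<Rightarrow> bool" where
  "pcauchy X \<longleftrightarrow> (\<forall>e>0. \<exists>N. \<forall>m\<ge>N. \<forall>n\<ge>N. pnorm (X m - X n) < e)"

lemma pcauchy_const: "pcauchy (\<lambda>n. t)"
  by (simp add: pcauchy_def pnorm_zero)

lemma pcauchy_add:
  assumes "pcauchy X" "pcauchy Y"
  shows "pcauchy (\<lambda>n. X n + Y n)"
  unfolding pcauchy_def
proof (intro allI impI)
  fix e :: real assume e: "e > 0"
  obtain M where M: "\<And>m n. m \<ge> M \<Longrightarrow> n \<ge> M \<Longrightarrow> pnorm (X m - X n) < e / 2"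
    using assms(1) e unfolding pcauchy_def by (meson half_gt_zero)
  obtain N where N: "\<And>m n. m \<ge> N \<Longrightarrow> n \<ge> N \<Longrightarrow> pnorm (Y m - Y n) < e / 2"
    using assms(2) e unfolding pcauchy_def by (meson half_gt_zero)
  have "pnorm (X m + Y m - (X n + Y n)) < e" if "m \<ge> max M N" "n \<ge> max M N" for m n
    using M[of m n] N[of m n] that pnorm_triangle[of "X m - X n" "Y m - Y n"]
    by (simp add: algebra_simps)
  then show "\<exists>N. \<forall>m\<ge>N. \<forall>n\<ge>N. pnorm (X m + Y m - (X n + Y n)) < e" by blast
qed

lemma pcauchy_scale:
  assumes "pcauchy X"
  shows "pcauchy (\<lambda>n. atensor_scale c (X n))"
  unfolding pcauchy_def
proof (intro allI impI)
  fix e :: real assume e: "e > 0"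
  have p: "cmod c + 1 > 0" by (rule add_nonneg_pos) auto
  with e have "e / (cmod c + 1) > 0" by simp
  then obtain N where N: "\<And>m n. m \<ge> N \<Longrightarrow> n \<ge> N \<Longrightarrow> pnorm (X m - X n) < e / (cmod c + 1)"
    using assms unfolding pcauchy_def by blast
  have "pnorm (atensor_scale c (X m) - atensor_scale c (X n)) < e" if "m \<ge> N" "n \<ge> N" for m n
  proof -
    have "cmod c * pnorm (X m - X n) \<le> (cmod c + 1) * pnorm (X m - X n)"
      by (intro mult_right_mono) (auto simp: pnorm_nonneg)
    also have "\<dots> < e" using N[OF that] p by (simp add: field_simps)
    finally show ?thesis by (simp add: pnorm_scale flip: atensor.scale_right_diff_distrib)
  qed
  then show "\<exists>N. \<forall>m\<ge>N. \<forall>n\<ge>N. pnorm (atensor_scale c (X m) - atensor_scale c (X n)) < e" by blast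
qed

lemma pcauchy_minus: "pcauchy X \<Longrightarrow> pcauchy (\<lambda>n. - X n)"
  using pcauchy_scale[of X "-1"] by simp

lemma pcauchy_diff: "pcauchy X \<Longrightarrow> pcauchy Y \<Longrightarrow> pcauchy (\<lambda>n. X n - Y n)"
  using pcauchy_add[of X "\<lambda>n. - Y n"] by (simp add: pcauchy_minus)

lemma pcauchy_pnorm:
  assumes "pcauchy X"
  shows "convergent (\<lambda>n. pnorm (X n))"
proof -
  have "Cauchy (\<lambda>n. pnorm (X n))"
  proof (rule CauchyI)
    fix e :: real assume "e > 0"
    then obtain N where "\<And>m n. m \<ge> N \<Longrightarrow> n \<ge> N \<Longrightarrow> pnorm (X m - X n) < e"
      using assms unfolding pcauchy_def by blast
    then show "\<exists>M. \<forall>m\<ge>M. \<forall>n\<ge>M. norm (pnorm (X m) - pnorm (X n)) < e"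
      using pnorm_triangle_diff by (metis order_le_less_trans real_norm_def)
  qed
  then show ?thesis by (simp add: Cauchy_convergent_iff)
qed

quotient_type (overloaded) ('a, 'b) ptensor =
  "nat \<Rightarrow> ('a::complex_normed_vector, 'b::complex_normed_vector) atensor" /
  partial: "\<lambda>X Y. pcauchy X \<and> pcauchy Y \<and> (\<lambda>n. pnorm (X n - Y n)) \<longlonglongrightarrow> 0"
proof (rule part_equivpI)
  show "\<exists>X. pcauchy X \<and> pcauchy X \<and> (\<lambda>n. pnorm (X n - X n :: ('a, 'b) atensor)) \<longlonglongrightarrow> 0"
    by (rule exI[of _ "\<lambda>n. 0"]) (simp add: pcauchy_const pnorm_zero)
  show "symp (\<lambda>X Y. pcauchy X \<and> pcauchy Y \<and> (\<lambda>n. pnorm (X n - Y n :: ('a, 'b) atensor)) \<longlonglongrightarrow> 0)"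
    by (rule sympI) (simp add: pnorm_minus_commute)
  show "transp (\<lambda>X Y. pcauchy X \<and> pcauchy Y \<and> (\<lambda>n. pnorm (X n - Y n :: ('a, 'b) atensor)) \<longlonglongrightarrow> 0)"
  proof (rule transpI, elim conjE, intro conjI)
    fix X Y Z :: "nat \<Rightarrow> ('a, 'b) atensor"
    assume a: "(\<lambda>n. pnorm (X n - Y n)) \<longlonglongrightarrow> 0" and b: "(\<lambda>n. pnorm (Y n - Z n)) \<longlonglongrightarrow> 0"
    show "(\<lambda>n. pnorm (X n - Z n)) \<longlonglongrightarrow> 0"
    proof (rule tendsto_sandwich[OF _ _ tendsto_const])
      show "(\<lambda>n. pnorm (X n - Y n) + pnorm (Y n - Z n)) \<longlonglongrightarrow> 0"
        using tendsto_add[OF a b] by simp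
      show "\<forall>\<^sub>F n in sequentially. pnorm (X n - Z n) \<le> pnorm (X n - Y n) + pnorm (Y n - Z n)"
        using pnorm_triangle[of "X n - Y n" "Y n - Z n" for n] by simp
    qed (simp add: pnorm_nonneg)
  qed
qed

lemma pnorm_tendsto_0_le:
  assumes "\<And>n. pnorm (X n) \<le> f n" "f \<longlonglongrightarrow> 0"
  shows "(\<lambda>n. pnorm (X n)) \<longlonglongrightarrow> 0"
  by (rule tendsto_sandwich[OF _ _ tendsto_const assms(2)]) (auto simp: assms(1) pnorm_nonneg)

instantiation ptensor :: (complex_normed_vector, complex_normed_vector) complex_normed_vector
begin
lift_definition zero_ptensor :: "('a, 'b) ptensor" is "\<lambda>n. 0"
  by (simp add: pcauchy_const pnorm_zero)
lift_definition plus_ptensor :: "('a, 'b) ptensor \<Rightarrow> ('a, 'b) ptensor \<Rightarrow> ('a, 'b) ptensor"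
  is "\<lambda>X Y n. X n + Y n"
proof (elim conjE, intro conjI)
  fix X X' Y Y' :: "nat \<Rightarrow> ('a, 'b) atensor"
  assume "(\<lambda>n. pnorm (X n - X' n)) \<longlonglongrightarrow> 0" "(\<lambda>n. pnorm (Y n - Y' n)) \<longlonglongrightarrow> 0"
  then have *: "(\<lambda>n. pnorm (X n - X' n) + pnorm (Y n - Y' n)) \<longlonglongrightarrow> 0"
    using tendsto_add[of "\<lambda>n. pnorm (X n - X' n)" 0] by fastforce
  show "(\<lambda>n. pnorm (X n + Y n - (X' n + Y' n))) \<longlonglongrightarrow> 0"
  proof (rule pnorm_tendsto_0_le[OF _ *])
    fix n
    show "pnorm (X n + Y n - (X' n + Y' n)) \<le> pnorm (X n - X' n) + pnorm (Y n - Y' n)"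
      using pnorm_triangle[of "X n - X' n" "Y n - Y' n"] by (simp add: algebra_simps)
  qed
qed (auto intro: pcauchy_add)
lift_definition scaleC_ptensor :: "complex \<Rightarrow> ('a, 'b) ptensor \<Rightarrow> ('a, 'b) ptensor"
  is "\<lambda>c X n. atensor_scale c (X n)"
  by (auto intro: pcauchy_scale tendsto_mult_right_zero simp: pnorm_scale simp flip: atensor.scale_right_diff_distrib)
lift_definition uminus_ptensor :: "('a, 'b) ptensor \<Rightarrow> ('a, 'b) ptensor"
  is "\<lambda>X n. - X n"
  by (auto simp: pcauchy_minus pnorm_minus_commute)
definition minus_ptensor :: "('a, 'b) ptensor \<Rightarrow> ('a, 'b) ptensor \<Rightarrow> ('a, 'b) ptensor" where
  "minus_ptensor S T = S + - T"
definition scaleR_ptensor :: "real \<Rightarrow> ('a, 'b) ptensor \<Rightarrow> ('a, 'b) ptensor" where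
  "scaleR_ptensor r T = scaleC (complex_of_real r) T"
lift_definition norm_ptensor :: "('a, 'b) ptensor \<Rightarrow> real" is "\<lambda>X. lim (\<lambda>n. pnorm (X n))"
proof (elim conjE)
  fix X Y :: "nat \<Rightarrow> ('a, 'b) atensor"
  assume X: "pcauchy X" and Y: "(\<lambda>n. pnorm (X n - Y n)) \<longlonglongrightarrow> 0"
  have lim: "(\<lambda>n. pnorm (X n)) \<longlonglongrightarrow> lim (\<lambda>n. pnorm (X n))"
    using pcauchy_pnorm[OF X] by (simp add: convergent_LIMSEQ_iff)
  have "(\<lambda>n. pnorm (Y n) - pnorm (X n)) \<longlonglongrightarrow> 0"
    by (rule tendsto_rabs_zero_cancel, rule tendsto_sandwich[OF _ _ tendsto_const Y])
       (auto simp: abs_minus_commute intro!: always_eventually pnorm_triangle_diff)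
  from tendsto_add[OF lim this] have "(\<lambda>n. pnorm (Y n)) \<longlonglongrightarrow> lim (\<lambda>n. pnorm (X n))" by simp
  then show "lim (\<lambda>n. pnorm (X n)) = lim (\<lambda>n. pnorm (Y n))" by (simp add: limI)
qed
definition dist_ptensor :: "('a, 'b) ptensor \<Rightarrow> ('a, 'b) ptensor \<Rightarrow> real" where
  "dist_ptensor S T = norm (S - T)"
definition sgn_ptensor :: "('a, 'b) ptensor \<Rightarrow> ('a, 'b) ptensor" where
  "sgn_ptensor T = scaleR (inverse (norm T)) T"
definition uniformity_ptensor :: "(('a, 'b) ptensor \<times> ('a, 'b) ptensor) filter" where
  "uniformity_ptensor = (INF e\<in>{0<..}. principal {(x, y). dist x y < e})"
definition open_ptensor :: "('a, 'b) ptensor set \<Rightarrow> bool" where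
  "open_ptensor U \<longleftrightarrow> (\<forall>x\<in>U. \<forall>\<^sub>F (x', y) in uniformity. x' = x \<longrightarrow> y \<in> U)"

lemma pcauchy_lim: "pcauchy X \<Longrightarrow> (\<lambda>n. pnorm (X n)) \<longlonglongrightarrow> lim (\<lambda>n. pnorm (X n))"
  using pcauchy_pnorm by (simp add: convergent_LIMSEQ_iff)

instance
proof
  fix S T U :: "('a, 'b) ptensor" and r s :: real and c d :: complex
  show "S + T + U = S + (T + U)"
    by transfer (auto intro!: pcauchy_add simp: add.assoc pnorm_zero)
  show "S + T = T + S"
    by transfer (auto intro!: pcauchy_add simp: add.commute pnorm_zero)
  show "0 + S = S" by transfer (auto simp: pnorm_zero)
  show "- S + S = 0"
    by transfer (auto simp: pnorm_zero intro!: pcauchy_const)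
  show "S - T = S + - T" by (rule minus_ptensor_def)
  have add_right: "c *\<^sub>C (S + T) = c *\<^sub>C S + c *\<^sub>C T" for c and S T :: "('a, 'b) ptensor"
    by transfer (auto intro!: pcauchy_add pcauchy_scale simp: atensor.scale_right_distrib pnorm_zero)
  have add_left: "(c + d) *\<^sub>C S = c *\<^sub>C S + d *\<^sub>C S" for c d and S :: "('a, 'b) ptensor"
    by transfer (auto intro!: pcauchy_add pcauchy_scale simp: atensor.scale_left_distrib pnorm_zero)
  have assoc: "c *\<^sub>C d *\<^sub>C S = (c * d) *\<^sub>C S" for c d and S :: "('a, 'b) ptensor"
    by transfer (auto intro!: pcauchy_scale simp: pnorm_zero)
  have one: "1 *\<^sub>C S = S" for S :: "('a, 'b) ptensor"
    by transfer (auto simp: pnorm_zero)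
  have norm_scale: "norm (c *\<^sub>C S) = cmod c * norm S" for c and S :: "('a, 'b) ptensor"
    by transfer (auto simp: pnorm_scale intro!: limI tendsto_mult_left pcauchy_lim)
  show "c *\<^sub>C (S + T) = c *\<^sub>C S + c *\<^sub>C T" by (rule add_right)
  show "(c + d) *\<^sub>C S = c *\<^sub>C S + d *\<^sub>C S" by (rule add_left)
  show "c *\<^sub>C d *\<^sub>C S = (c * d) *\<^sub>C S" by (rule assoc)
  show "r *\<^sub>R S = complex_of_real r *\<^sub>C S" by (rule scaleR_ptensor_def)
  show "norm (c *\<^sub>C S) = cmod c * norm S" by (rule norm_scale)
  show "r *\<^sub>R (S + T) = r *\<^sub>R S + r *\<^sub>R T" by (simp add: scaleR_ptensor_def add_right)
  show "(r + s) *\<^sub>R S = r *\<^sub>R S + s *\<^sub>R S" by (simp add: scaleR_ptensor_def add_left)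
  show "r *\<^sub>R s *\<^sub>R S = (r * s) *\<^sub>R S" by (simp add: scaleR_ptensor_def assoc)
  show "1 *\<^sub>R S = S" by (simp add: scaleR_ptensor_def one)
  show "norm (r *\<^sub>R S) = \<bar>r\<bar> * norm S" by (simp add: scaleR_ptensor_def norm_scale)
  show "norm S = 0 \<longleftrightarrow> S = 0"
  proof transfer
    fix X :: "nat \<Rightarrow> ('a, 'b) atensor"
    assume "pcauchy X \<and> pcauchy X \<and> (\<lambda>n. pnorm (X n - X n)) \<longlonglongrightarrow> 0"
    then have X: "pcauchy X" by blast
    have "lim (\<lambda>n. pnorm (X n)) = 0 \<longleftrightarrow> (\<lambda>n. pnorm (X n)) \<longlonglongrightarrow> 0"
      using pcauchy_lim[OF X] limI by metis
    then show "lim (\<lambda>n. pnorm (X n)) = 0 \<longleftrightarrow>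
        pcauchy X \<and> pcauchy (\<lambda>n. 0 :: ('a, 'b) atensor) \<and> (\<lambda>n. pnorm (X n - 0)) \<longlonglongrightarrow> 0"
      by (simp add: X pcauchy_const)
  qed
  show "norm (S + T) \<le> norm S + norm T"
  proof transfer
    fix X Y :: "nat \<Rightarrow> ('a, 'b) atensor"
    assume "pcauchy X \<and> pcauchy X \<and> (\<lambda>n. pnorm (X n - X n)) \<longlonglongrightarrow> 0"
      and "pcauchy Y \<and> pcauchy Y \<and> (\<lambda>n. pnorm (Y n - Y n)) \<longlonglongrightarrow> 0"
    then have XY: "pcauchy X" "pcauchy Y" by auto
    show "lim (\<lambda>n. pnorm (X n + Y n)) \<le> lim (\<lambda>n. pnorm (X n)) + lim (\<lambda>n. pnorm (Y n))"
      by (rule LIMSEQ_le[OF pcauchy_lim[OF pcauchy_add[OF XY]] tendsto_add[OF XY[THEN pcauchy_lim]]])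
         (auto intro: pnorm_triangle)
  qed
  show "dist S T = norm (S - T)" by (rule dist_ptensor_def)
  show "sgn S = scaleR (inverse (norm S)) S" by (rule sgn_ptensor_def)
  show "(uniformity :: (('a, 'b) ptensor \<times> ('a, 'b) ptensor) filter) =
      (INF e\<in>{0<..}. principal {(x, y). dist x y < e})"
    by (rule uniformity_ptensor_def)
  show "open V \<longleftrightarrow> (\<forall>x\<in>V. \<forall>\<^sub>F (x', y) in uniformity. x' = x \<longrightarrow> y \<in> V)" for V :: "('a, 'b) ptensor set"
    by (rule open_ptensor_def)
qed
end

definition of_atensor ::
  "('a::complex_normed_vector, 'b::complex_normed_vector) atensor \<Rightarrow> ('a, 'b) ptensor" where
  "of_atensor t = abs_ptensor (\<lambda>n. t)"

definition ptensor :: "'a::complex_normed_vector \<Rightarrow> 'b::complex_normed_vector \<Rightarrow> ('a, 'b) ptensor"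
    (infixr \<open>\<otimes>\<^sub>p\<close> 72) where
  "x \<otimes>\<^sub>p y = of_atensor (atensor x y)"

lemma norm_of_atensor: "norm (of_atensor t) = pnorm t"
  by (simp add: of_atensor_def norm_ptensor.abs_eq pcauchy_const pnorm_zero limI)

lemma of_atensor_add: "of_atensor (s + t) = of_atensor s + of_atensor t"
  by (simp add: of_atensor_def plus_ptensor.abs_eq pcauchy_const pnorm_zero)

lemma of_atensor_minus: "of_atensor (- t) = - of_atensor t"
  by (simp add: of_atensor_def uminus_ptensor.abs_eq pcauchy_const pnorm_zero)

lemma of_atensor_diff: "of_atensor (s - t) = of_atensor s - of_atensor t"
  using of_atensor_add[of s "- t"] by (simp add: of_atensor_minus)

lemma of_atensor_scale: "of_atensor (atensor_scale c t) = c *\<^sub>C of_atensor t"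
  by (simp add: of_atensor_def scaleC_ptensor.abs_eq pcauchy_const pnorm_zero)

lemma of_atensor_zero: "of_atensor 0 = 0"
  using of_atensor_add[of 0 0] by simp

lemma ptensor_cases:
  obtains X where "pcauchy X" "T = abs_ptensor X"
proof (rule that)
  show "pcauchy (rep_ptensor T)"
    using Quotient_rep_reflp[OF Quotient_ptensor, of T] by blast
  show "T = abs_ptensor (rep_ptensor T)"
    by (rule Quotient_abs_rep[OF Quotient_ptensor, symmetric])
qed

lemma of_atensor_tendsto:
  assumes "pcauchy X"
  shows "(\<lambda>k. of_atensor (X k)) \<longlonglongrightarrow> abs_ptensor X"
proof (rule LIMSEQ_I)
  fix e :: real assume e: "e > 0"
  then obtain N where N: "\<And>m n. m \<ge> N \<Longrightarrow> n \<ge> N \<Longrightarrow> pnorm (X m - X n) < e / 2"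
    using assms unfolding pcauchy_def by (meson half_gt_zero)
  have "norm (of_atensor (X k) - abs_ptensor X) < e" if k: "k \<ge> N" for k
  proof -
    have c: "pcauchy (\<lambda>n. X k - X n)" by (intro pcauchy_diff pcauchy_const assms)
    have "of_atensor (X k) - abs_ptensor X = abs_ptensor (\<lambda>n. X k - X n)"
      unfolding minus_ptensor_def of_atensor_def
      by (simp add: uminus_ptensor.abs_eq plus_ptensor.abs_eq assms pcauchy_const pcauchy_minus
          eq_onp_def pnorm_zero)
    then have "norm (of_atensor (X k) - abs_ptensor X) = lim (\<lambda>n. pnorm (X k - X n))"
      using c by (simp add: norm_ptensor.abs_eq pnorm_zero)
    also have "\<dots> \<le> e / 2"
      by (rule LIMSEQ_le_const2[OF pcauchy_lim[OF c]]) (use N[OF k] in \<open>auto intro!: exI[of _ N] less_imp_le\<close>)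
    finally show ?thesis using e by simp
  qed
  then show "\<exists>N. \<forall>k\<ge>N. norm (of_atensor (X k) - abs_ptensor X) < e" by blast
qed

lemma of_atensor_dense: "e > 0 \<Longrightarrow> \<exists>t. norm (T - of_atensor t) < e"
proof -
  assume e: "e > 0"
  obtain X where X: "pcauchy X" "T = abs_ptensor X" by (rule ptensor_cases)
  from LIMSEQ_D[OF of_atensor_tendsto[OF X(1)] e] show ?thesis
    unfolding X(2) by (metis norm_minus_commute order_refl)
qed

instance ptensor :: (complex_normed_vector, complex_normed_vector) banach
proof
  fix T :: "nat \<Rightarrow> ('a, 'b) ptensor"
  assume T: "Cauchy T"
  have "\<forall>k. \<exists>t. norm (T k - of_atensor t) < inverse (real (Suc k))"
    by (intro allI of_atensor_dense) simp
  then obtain X where X: "\<And>k. norm (T k - of_atensor (X k)) < inverse (real (Suc k))"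
    by metis
  have D: "(\<lambda>k. T k - of_atensor (X k)) \<longlonglongrightarrow> 0"
    by (rule Lim_null_comparison[OF _ LIMSEQ_inverse_real_of_nat]) (use X in \<open>auto intro!: always_eventually less_imp_le simp del: of_nat_Suc\<close>)
  have "Cauchy (\<lambda>k. of_atensor (X k))"
  proof (rule CauchyI)
    fix e :: real assume e: "e > 0"
    obtain M where M: "\<And>m n. m \<ge> M \<Longrightarrow> n \<ge> M \<Longrightarrow> norm (T m - T n) < e / 3"
      using CauchyD[OF T, of "e / 3"] e by auto
    obtain N where N: "\<And>n. n \<ge> N \<Longrightarrow> norm (T n - of_atensor (X n)) < e / 3"
      using LIMSEQ_D[OF D, of "e / 3"] e by auto
    have "norm (of_atensor (X m) - of_atensor (X n)) < e" if "m \<ge> max M N" "n \<ge> max M N" for m n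
      using norm_triangle_ineq4[of "T m - T n" "(T m - of_atensor (X m)) - (T n - of_atensor (X n))"]
        norm_triangle_ineq4[of "T m - of_atensor (X m)" "T n - of_atensor (X n)"]
        M[of m n] N[of m] N[of n] that by (simp add: algebra_simps)
    then show "\<exists>M. \<forall>m\<ge>M. \<forall>n\<ge>M. norm (of_atensor (X m) - of_atensor (X n)) < e" by blast
  qed
  then have "pcauchy X"
    unfolding Cauchy_iff pcauchy_def by (simp add: norm_of_atensor flip: of_atensor_diff)
  from tendsto_add[OF D of_atensor_tendsto[OF this]] show "convergent T"
    by (auto simp: convergent_def)
qed

lemma bounded_cbilinear_ptensor: "bounded_cbilinear (\<otimes>\<^sub>p)"
proof -
  have c: "(c *\<^sub>C x) \<otimes>\<^sub>p y = c *\<^sub>C (x \<otimes>\<^sub>p y)" "x \<otimes>\<^sub>p (c *\<^sub>C y) = c *\<^sub>C (x \<otimes>\<^sub>p y)"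
    for c and x :: 'a and y :: 'b
    by (simp_all add: ptensor_def atensor_scaleC_left atensor_scaleC_right of_atensor_scale)
  have "bounded_bilinear ((\<otimes>\<^sub>p) :: 'a \<Rightarrow> 'b \<Rightarrow> _)"
    by (standard, simp_all add: scaleR_scaleC c)
       (auto simp: ptensor_def atensor_add_left atensor_add_right of_atensor_add norm_of_atensor
         intro!: exI[of _ 1] pnorm_atensor_le)
  with c show ?thesis by (simp add: bounded_cbilinear_def)
qed

text \<open>The bounded linear map determined by its values on elementary tensors.\<close>

definition ptensor_lift ::
  "('a::complex_normed_vector \<Rightarrow> 'b::complex_normed_vector \<Rightarrow> 'c::complex_normed_vector)
    \<Rightarrow> ('a, 'b) ptensor \<Rightarrow> 'c" where
  "ptensor_lift \<phi> = (THE f. bounded_clinear f \<and> (\<forall>x y. f (x \<otimes>\<^sub>p y) = \<phi> x y))"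

lemma bounded_clinear_ptensor_eqI:
  fixes f g :: "('a::complex_normed_vector, 'b::complex_normed_vector) ptensor \<Rightarrow> 'c::complex_normed_vector"
  assumes "bounded_clinear f" "bounded_clinear g" "\<And>x y. f (x \<otimes>\<^sub>p y) = g (x \<otimes>\<^sub>p y)"
  shows "f = g"
proof
  fix T :: "('a, 'b) ptensor"
  interpret f: bounded_linear f using assms(1) by (simp add: bounded_clinear_def)
  interpret g: bounded_linear g using assms(2) by (simp add: bounded_clinear_def)
  have *: "f (of_atensor t) = g (of_atensor t)" for t
  proof -
    obtain xs where t: "t = (\<Sum>(x, y)\<leftarrow>xs. atensor x y)" using atensor_repr by blast
    show ?thesis unfolding t
      by (induction xs) (auto simp: of_atensor_zero of_atensor_add f.add g.add f.zero g.zero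
          assms(3) simp flip: ptensor_def)
  qed
  obtain X where X: "pcauchy X" "T = abs_ptensor X" by (rule ptensor_cases)
  note lim = of_atensor_tendsto[OF X(1)]
  from f.tendsto[OF lim] g.tendsto[OF lim] show "f T = g T"
    unfolding X(2) * by (rule LIMSEQ_unique)
qed

lemma ptensor_lift_exists:
  fixes \<phi> :: "'a::complex_normed_vector \<Rightarrow> 'b::complex_normed_vector \<Rightarrow> 'c::{complex_normed_vector, banach}"
  assumes "bounded_cbilinear \<phi>"
  shows "\<exists>f. bounded_clinear f \<and> (\<forall>x y. f (x \<otimes>\<^sub>p y) = \<phi> x y)"
proof -
  obtain K where K: "K > 0" "\<And>t. norm (atensor_ext \<phi> t) \<le> K * pnorm t"
    using atensor_ext_bound[OF assms] by blast
  have conv: "convergent (\<lambda>n. atensor_ext \<phi> (X n))" if X: "pcauchy X" for X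
  proof -
    have "Cauchy (\<lambda>n. atensor_ext \<phi> (X n))"
    proof (rule CauchyI)
      fix e :: real assume "e > 0"
      then have "e / K > 0" using K(1) by simp
      then obtain N where N: "\<And>m n. m \<ge> N \<Longrightarrow> n \<ge> N \<Longrightarrow> pnorm (X m - X n) < e / K"
        using X unfolding pcauchy_def by blast
      have "norm (atensor_ext \<phi> (X m) - atensor_ext \<phi> (X n)) < e" if "m \<ge> N" "n \<ge> N" for m n
        using N[OF that] K(2)[of "X m - X n"] K(1) by (simp add: atensor_ext_diff field_simps)
      then show "\<exists>M. \<forall>m\<ge>M. \<forall>n\<ge>M. norm (atensor_ext \<phi> (X m) - atensor_ext \<phi> (X n)) < e" by blast
    qed
    then show ?thesis by (simp add: Cauchy_convergent_iff)
  qed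
  define f where "f T = lim (\<lambda>n. atensor_ext \<phi> (rep_ptensor T n))" for T
  have f: "(\<lambda>n. atensor_ext \<phi> (X n)) \<longlonglongrightarrow> f (abs_ptensor X)" if X: "pcauchy X" for X
  proof -
    define Y where "Y = rep_ptensor (abs_ptensor X)"
    have Y: "pcauchy Y" "(\<lambda>n. pnorm (X n - Y n)) \<longlonglongrightarrow> 0"
      using Quotient_rep_abs[OF Quotient_ptensor, of X] X
      by (auto simp: Y_def pnorm_zero pnorm_minus_commute)
    have "(\<lambda>n. atensor_ext \<phi> (X n) - atensor_ext \<phi> (Y n)) \<longlonglongrightarrow> 0"
      by (rule Lim_null_comparison[OF _ tendsto_mult_right_zero[OF Y(2), of K]])
         (use K(2) in \<open>auto simp flip: atensor_ext_diff\<close>)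
    moreover have "(\<lambda>n. atensor_ext \<phi> (Y n)) \<longlonglongrightarrow> f (abs_ptensor X)"
      using conv[OF Y(1)] by (simp add: convergent_LIMSEQ_iff f_def Y_def)
    ultimately show ?thesis using tendsto_add by fastforce
  qed
  have f_at: "f (of_atensor t) = atensor_ext \<phi> t" for t
    using f[OF pcauchy_const[of t]] by (simp add: LIMSEQ_const_iff of_atensor_def)
  have f_add: "f (S + T) = f S + f T" for S T
  proof -
    obtain X where X: "pcauchy X" "S = abs_ptensor X" by (rule ptensor_cases)
    obtain Y where Y: "pcauchy Y" "T = abs_ptensor Y" by (rule ptensor_cases)
    have "S + T = abs_ptensor (\<lambda>n. X n + Y n)"
      using X Y by (simp add: plus_ptensor.abs_eq pnorm_zero)
    then have "(\<lambda>n. atensor_ext \<phi> (X n + Y n)) \<longlonglongrightarrow> f (S + T)"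
      using f[OF pcauchy_add[OF X(1) Y(1)]] by simp
    moreover have "(\<lambda>n. atensor_ext \<phi> (X n + Y n)) \<longlonglongrightarrow> f S + f T"
      unfolding atensor_ext_add X(2) Y(2) by (intro tendsto_add f X Y)
    ultimately show ?thesis by (rule LIMSEQ_unique)
  qed
  have f_scale: "f (c *\<^sub>C T) = c *\<^sub>C f T" for c T
  proof -
    obtain X where X: "pcauchy X" "T = abs_ptensor X" by (rule ptensor_cases)
    have "c *\<^sub>C T = abs_ptensor (\<lambda>n. atensor_scale c (X n))"
      using X by (simp add: scaleC_ptensor.abs_eq pnorm_zero)
    then have "(\<lambda>n. atensor_ext \<phi> (atensor_scale c (X n))) \<longlonglongrightarrow> f (c *\<^sub>C T)"
      using f[OF pcauchy_scale[OF X(1)]] by simp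
    moreover have "(\<lambda>n. atensor_ext \<phi> (atensor_scale c (X n))) \<longlonglongrightarrow> c *\<^sub>C f T"
      unfolding atensor_ext_scale X(2) by (intro bounded_linear.tendsto[OF bounded_linear_scaleC] f X)
    ultimately show ?thesis by (rule LIMSEQ_unique)
  qed
  have f_norm: "norm (f T) \<le> norm T * K" for T
  proof -
    obtain X where X: "pcauchy X" "T = abs_ptensor X" by (rule ptensor_cases)
    have "(\<lambda>n. K * pnorm (X n)) \<longlonglongrightarrow> K * norm T"
      unfolding X(2) norm_of_atensor[symmetric] by (intro tendsto_intros of_atensor_tendsto X)
    moreover have "(\<lambda>n. norm (atensor_ext \<phi> (X n))) \<longlonglongrightarrow> norm (f T)"
      unfolding X(2) by (intro tendsto_norm f X)
    ultimately have "norm (f T) \<le> K * norm T"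
      using LIMSEQ_le K(2) by blast
    then show ?thesis by (simp add: mult.commute)
  qed
  have "bounded_linear f"
    by (rule bounded_linear_intro[where K = K]) (auto simp: f_add scaleR_scaleC f_scale f_norm)
  then have "bounded_clinear f" by (simp add: bounded_clinear_def f_scale)
  moreover have "f (x \<otimes>\<^sub>p y) = \<phi> x y" for x y
    by (simp add: ptensor_def f_at atensor_ext_atensor[OF assms])
  ultimately show ?thesis by blast
qed

lemma
  fixes \<phi> :: "'a::complex_normed_vector \<Rightarrow> 'b::complex_normed_vector \<Rightarrow> 'c::{complex_normed_vector, banach}"
  assumes "bounded_cbilinear \<phi>"
  shows bounded_clinear_ptensor_lift: "bounded_clinear (ptensor_lift \<phi>)"
    and ptensor_lift_ptensor: "ptensor_lift \<phi> (x \<otimes>\<^sub>p y) = \<phi> x y"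
proof -
  have "\<exists>!f. bounded_clinear f \<and> (\<forall>x y. f (x \<otimes>\<^sub>p y) = \<phi> x y)"
    using ptensor_lift_exists[OF assms] by (auto intro: bounded_clinear_ptensor_eqI)
  from theI'[OF this] show "bounded_clinear (ptensor_lift \<phi>)" "ptensor_lift \<phi> (x \<otimes>\<^sub>p y) = \<phi> x y"
    unfolding ptensor_lift_def by blast+
qed


section \<open>Adjoints, dual and bidual module structures\<close>

definition adjoint_map ::
  "('x::complex_normed_vector \<Rightarrow> 'y::complex_normed_vector) \<Rightarrow> 'y cdual \<Rightarrow> 'x cdual" where
  "adjoint_map T f = Cdual (\<lambda>x. cdual_apply f (T x))"

definition bidual_embed :: "'x::complex_normed_vector \<Rightarrow> 'x cdual cdual" where
  "bidual_embed x = Cdual (\<lambda>f. cdual_apply f x)"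

text \<open>
  For a bimodule \<open>X\<close> with left action \<open>l\<close> and right action \<open>r\<close>, the dual actions are
  \<open>(a \<cdot> f)(x) = f(x \<cdot> a)\<close> and \<open>(f \<cdot> a)(x) = f(a \<cdot> x)\<close>; applying this twice gives the bidual actions
  \<open>(a \<cdot> m)(f) = m(f \<cdot> a)\<close> and \<open>(m \<cdot> a)(f) = m(a \<cdot> f)\<close>.
\<close>

definition dual_left :: "('x::complex_normed_vector \<Rightarrow> 'a \<Rightarrow> 'x) \<Rightarrow> 'a \<Rightarrow> 'x cdual \<Rightarrow> 'x cdual" where
  "dual_left r a f = Cdual (\<lambda>x. cdual_apply f (r x a))"

definition dual_right :: "('a \<Rightarrow> 'x::complex_normed_vector \<Rightarrow> 'x) \<Rightarrow> 'x cdual \<Rightarrow> 'a \<Rightarrow> 'x cdual" where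
  "dual_right l f a = Cdual (\<lambda>x. cdual_apply f (l a x))"

definition bidual_left ::
  "('a \<Rightarrow> 'x::complex_normed_vector \<Rightarrow> 'x) \<Rightarrow> 'a \<Rightarrow> 'x cdual cdual \<Rightarrow> 'x cdual cdual" where
  "bidual_left l = dual_left (dual_right l)"

definition bidual_right ::
  "('x::complex_normed_vector \<Rightarrow> 'a \<Rightarrow> 'x) \<Rightarrow> 'x cdual cdual \<Rightarrow> 'a \<Rightarrow> 'x cdual cdual" where
  "bidual_right r = dual_right (dual_left r)"

definition tensor_left ::
  "'a::complex_banach_algebra \<Rightarrow> ('a, 'a) ptensor \<Rightarrow> ('a, 'a) ptensor" where
  "tensor_left a = ptensor_lift (\<lambda>b c. (a * b) \<otimes>\<^sub>p c)"

definition tensor_right ::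
  "('a, 'a) ptensor \<Rightarrow> 'a::complex_banach_algebra \<Rightarrow> ('a, 'a) ptensor" where
  "tensor_right t a = ptensor_lift (\<lambda>b c. b \<otimes>\<^sub>p (c * a)) t"

definition tensor_mult :: "('a::complex_banach_algebra, 'a) ptensor \<Rightarrow> 'a" where
  "tensor_mult = ptensor_lift (*)"

lemma bounded_clinear_compose:
  assumes "bounded_clinear f" "bounded_clinear g"
  shows "bounded_clinear (\<lambda>x. f (g x))"
  using assms by (simp add: bounded_clinear_def bounded_linear_compose)

lemma cdual_apply_adjoint_map:
  "bounded_clinear T \<Longrightarrow> cdual_apply (adjoint_map T f) x = cdual_apply f (T x)"
  unfolding adjoint_map_def
  by (simp add: cdual_apply_Cdual bounded_clinear_compose[OF bounded_clinear_cdual_apply])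

lemma bounded_clinear_eval: "bounded_clinear (\<lambda>f. cdual_apply f x)"
proof -
  have "bounded_linear (\<lambda>f. cdual_apply f x)"
    by (rule bounded_linear_intro[where K = "norm x"])
       (simp_all add: scaleR_scaleC cdual_apply_simps scaleC_complex_def norm_cdual_apply_le)
  then show ?thesis by (simp add: bounded_clinear_def cdual_apply_simps scaleC_complex_def)
qed

lemma cdual_apply_bidual_embed: "cdual_apply (bidual_embed x) f = cdual_apply f x"
  unfolding bidual_embed_def by (simp add: cdual_apply_Cdual bounded_clinear_eval)

lemma bounded_clinear_adjoint_map:
  assumes "bounded_clinear T"
  shows "bounded_clinear (adjoint_map T)"
proof -
  obtain K where K: "K \<ge> 0" "\<And>x. norm (T x) \<le> norm x * K"
    using bounded_linear.nonneg_bounded assms unfolding bounded_clinear_def by metis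
  have "bounded_linear (adjoint_map T)"
  proof (rule bounded_linear_intro[where K = K])
    show "norm (adjoint_map T f) \<le> norm f * K" for f
    proof (rule norm_cdual_le)
      fix x
      have "cmod (cdual_apply f (T x)) \<le> norm f * norm (T x)" by (rule norm_cdual_apply_le)
      also have "\<dots> \<le> norm f * (norm x * K)" by (intro mult_left_mono K) auto
      finally show "cmod (cdual_apply (adjoint_map T f) x) \<le> norm f * K * norm x"
        by (simp add: cdual_apply_adjoint_map[OF assms] algebra_simps)
    qed (use K in auto)
  qed (auto intro!: cdual_eqI simp: scaleR_scaleC cdual_apply_adjoint_map[OF assms] cdual_apply_simps)
  then show ?thesis
    by (auto simp: bounded_clinear_def cdual_apply_adjoint_map[OF assms] cdual_apply_simps intro!: cdual_eqI)
qed

text \<open>The module actions in terms of adjoints.\<close>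

lemma dual_left_adjoint: "dual_left r a = adjoint_map (\<lambda>x. r x a)"
  and dual_right_adjoint: "dual_right l f a = adjoint_map (l a) f"
  by (auto simp: dual_left_def dual_right_def adjoint_map_def)

lemma bidual_left_adjoint: "bidual_left l a = adjoint_map (adjoint_map (l a))"
  by (simp add: bidual_left_def dual_left_adjoint dual_right_adjoint)

lemma bidual_right_adjoint: "bidual_right r m a = adjoint_map (adjoint_map (\<lambda>x. r x a)) m"
  by (simp add: bidual_right_def dual_left_adjoint dual_right_adjoint)

lemma bounded_clinear_mult_left: "bounded_clinear (\<lambda>x. a * (x :: 'a::complex_banach_algebra))"
  by (simp add: bounded_clinear_def bounded_linear_mult_right mult_scaleC_right)

lemma bounded_clinear_mult_right: "bounded_clinear (\<lambda>x. (x :: 'a::complex_banach_algebra) * a)"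
  by (simp add: bounded_clinear_def bounded_linear_mult_left mult_scaleC_left)

lemma bounded_cbilinear_mult: "bounded_cbilinear ((*) :: 'a::complex_banach_algebra \<Rightarrow> 'a \<Rightarrow> 'a)"
  by (simp add: bounded_cbilinear_def bounded_bilinear_mult mult_scaleC_left mult_scaleC_right)

lemma bounded_cbilinear_comp:
  assumes "bounded_cbilinear \<phi>" "bounded_clinear f" "bounded_clinear g"
  shows "bounded_cbilinear (\<lambda>x y. \<phi> (f x) (g y))"
  using assms bounded_bilinear.comp[of \<phi> f g] by (simp add: bounded_cbilinear_def bounded_clinear_def)

lemma bounded_clinear_ident: "bounded_clinear (\<lambda>x. x)"
  by (simp add: bounded_clinear_def bounded_linear_ident)

lemma bounded_clinear_tensor_left: "bounded_clinear (tensor_left a)"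
  and tensor_left_ptensor: "tensor_left a (b \<otimes>\<^sub>p c) = (a * b) \<otimes>\<^sub>p c"
  unfolding tensor_left_def
  using bounded_cbilinear_comp[OF bounded_cbilinear_ptensor bounded_clinear_mult_left bounded_clinear_ident]
  by (rule bounded_clinear_ptensor_lift ptensor_lift_ptensor)+

lemma bounded_clinear_tensor_right: "bounded_clinear (\<lambda>t. tensor_right t a)"
  and tensor_right_ptensor: "tensor_right (b \<otimes>\<^sub>p c) a = b \<otimes>\<^sub>p (c * a)"
  unfolding tensor_right_def
  using bounded_cbilinear_comp[OF bounded_cbilinear_ptensor bounded_clinear_ident bounded_clinear_mult_right]
  by (rule bounded_clinear_ptensor_lift ptensor_lift_ptensor)+

lemma bounded_clinear_tensor_mult: "bounded_clinear tensor_mult"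
  and tensor_mult_ptensor: "tensor_mult (b \<otimes>\<^sub>p c) = b * c"
  unfolding tensor_mult_def
  using bounded_cbilinear_mult by (rule bounded_clinear_ptensor_lift ptensor_lift_ptensor)+


section \<open>Nets\<close>

definition directed_on :: "'i set \<Rightarrow> ('i \<Rightarrow> 'i \<Rightarrow> bool) \<Rightarrow> bool" where
  "directed_on I le \<longleftrightarrow> I \<noteq> {} \<and> (\<forall>i\<in>I. le i i) \<and>
    (\<forall>i\<in>I. \<forall>j\<in>I. \<forall>k\<in>I. le i j \<longrightarrow> le j k \<longrightarrow> le i k) \<and>
    (\<forall>i\<in>I. \<forall>j\<in>I. \<exists>k\<in>I. le i k \<and> le j k)"

definition net_filter :: "'i set \<Rightarrow> ('i \<Rightarrow> 'i \<Rightarrow> bool) \<Rightarrow> 'i filter" where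
  "net_filter I le = (INF i\<in>I. principal {j\<in>I. le i j})"

lemma directed_on_trans:
  "directed_on I le \<Longrightarrow> i \<in> I \<Longrightarrow> j \<in> I \<Longrightarrow> k \<in> I \<Longrightarrow> le i j \<Longrightarrow> le j k \<Longrightarrow> le i k"
  unfolding directed_on_def by (elim conjE) metis

lemma eventually_net_filter:
  assumes "directed_on I le"
  shows "eventually P (net_filter I le) \<longleftrightarrow> (\<exists>i\<in>I. \<forall>j\<in>I. le i j \<longrightarrow> P j)"
proof -
  have "eventually P (net_filter I le) \<longleftrightarrow> (\<exists>i\<in>I. eventually P (principal {j\<in>I. le i j}))"
    unfolding net_filter_def
  proof (rule eventually_INF_base)
    show "I \<noteq> {}" using assms by (simp add: directed_on_def)
    fix i j assume "i \<in> I" "j \<in> I"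
    with assms obtain k where "k \<in> I" "le i k" "le j k" unfolding directed_on_def by meson
    with \<open>i \<in> I\<close> \<open>j \<in> I\<close>
    show "\<exists>k\<in>I. principal {n\<in>I. le k n} \<le> inf (principal {n\<in>I. le i n}) (principal {n\<in>I. le j n})"
      by (intro bexI[of _ k]) (auto intro: directed_on_trans[OF assms, of _ k])
  qed
  then show ?thesis by (auto simp: eventually_principal)
qed

text \<open>
  A definition asserting the existence of a net cannot quantify over all index types. It is
  enough to let the net in \<open>'x\<close> be indexed by a directed subset of \<open>'x set \<times> 'x\<close>: every net in
  \<open>'x\<close> can be replaced by one so indexed, with values among the original ones and the same limits.
\<close>

lemma net_reindex:
  fixes m :: "'i \<Rightarrow> 'x"
  assumes dir: "directed_on I le"
  obtains J :: "('x set \<times> 'x) set" and le' and m' where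
    "directed_on J le'" "m' ` J \<subseteq> m ` I"
    "filtermap m' (net_filter J le') = filtermap m (net_filter I le)"
proof -
  define T where "T i = m ` {j\<in>I. le i j}" for i
  define J where "J = {(S, x). x \<in> S \<and> S \<in> T ` I}"
  define le' :: "'x set \<times> 'x \<Rightarrow> 'x set \<times> 'x \<Rightarrow> bool" where "le' p q \<longleftrightarrow> fst q \<subseteq> fst p" for p q
  have refl: "m i \<in> T i" if "i \<in> I" for i using dir that by (auto simp: T_def directed_on_def)
  have mono: "T k \<subseteq> T i" if "i \<in> I" "k \<in> I" "le i k" for i k
    using that unfolding T_def by (auto intro: directed_on_trans[OF dir, of i k])
  have dir': "directed_on J le'"
    unfolding directed_on_def
  proof (intro conjI ballI impI)
    obtain i where "i \<in> I" using dir by (auto simp: directed_on_def)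
    then have "(T i, m i) \<in> J" using refl by (auto simp: J_def)
    then show "J \<noteq> {}" by blast
  next
    fix p q assume "p \<in> J" "q \<in> J"
    then obtain i j where ij: "i \<in> I" "j \<in> I" "fst p = T i" "fst q = T j" by (auto simp: J_def)
    then obtain k where k: "k \<in> I" "le i k" "le j k" using dir unfolding directed_on_def by meson
    have "(T k, m k) \<in> J" using k refl by (auto simp: J_def)
    moreover have "le' p (T k, m k)" "le' q (T k, m k)"
      using mono[OF ij(1) k(1,2)] mono[OF ij(2) k(1,3)] ij by (auto simp: le'_def)
    ultimately show "\<exists>r\<in>J. le' p r \<and> le' q r" by blast
  qed (auto simp: le'_def)
  have ev: "eventually (\<lambda>i. P (m i)) (net_filter I le) \<longleftrightarrow> eventually (\<lambda>j. P (snd j)) (net_filter J le')" for P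
    unfolding eventually_net_filter[OF dir] eventually_net_filter[OF dir']
  proof
    assume "\<exists>i\<in>I. \<forall>j\<in>I. le i j \<longrightarrow> P (m j)"
    then obtain i where i: "i \<in> I" "\<forall>x\<in>T i. P x" by (auto simp: T_def)
    have "(T i, m i) \<in> J" using i refl by (auto simp: J_def)
    moreover have "P (snd q)" if "q \<in> J" "le' (T i, m i) q" for q
      using that i(2) by (auto simp: J_def le'_def)
    ultimately show "\<exists>p\<in>J. \<forall>q\<in>J. le' p q \<longrightarrow> P (snd q)" by blast
  next
    assume "\<exists>p\<in>J. \<forall>q\<in>J. le' p q \<longrightarrow> P (snd q)"
    then obtain p where p: "p \<in> J" "\<And>q. q \<in> J \<Longrightarrow> le' p q \<Longrightarrow> P (snd q)" by blast
    then obtain i where i: "i \<in> I" "fst p = T i" by (auto simp: J_def)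
    have "P (m j)" if "j \<in> I" "le i j" for j
      using p(2)[of "(T i, m j)"] i that by (auto simp: J_def le'_def T_def)
    with i show "\<exists>i\<in>I. \<forall>j\<in>I. le i j \<longrightarrow> P (m j)" by blast
  qed
  have "snd ` J \<subseteq> m ` I" by (auto simp: J_def T_def)
  moreover have "filtermap snd (net_filter J le') = filtermap m (net_filter I le)"
    by (simp add: filter_eq_iff eventually_filtermap ev)
  ultimately show ?thesis using dir' that by blast
qed


lemma tendsto_filtermap_eq:
  assumes "filtermap m' G = filtermap m F" "((\<lambda>i. g (m i)) \<longlongrightarrow> l) F"
  shows "((\<lambda>j. g (m' j)) \<longlongrightarrow> l) G"
  using assms tendsto_compose_filtermap[of g m l F] tendsto_compose_filtermap[of g m' l G]
  by (simp add: comp_def)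


section \<open>Approximate identities, Johnson pseudo-contractibility and property digamma\<close>

definition central_approximate_identity ::
  "'i set \<Rightarrow> ('i \<Rightarrow> 'i \<Rightarrow> bool) \<Rightarrow> ('i \<Rightarrow> 'a::complex_banach_algebra) \<Rightarrow> bool" where
  "central_approximate_identity I le e \<longleftrightarrow> directed_on I le \<and>
    (\<forall>i\<in>I. \<forall>a. a * e i = e i * a) \<and>
    (\<forall>a. ((\<lambda>i. e i * a) \<longlongrightarrow> a) (net_filter I le))"

type_synonym 'a tensor_bidual = "('a, 'a) ptensor cdual cdual"

abbreviation tensor_mult_bidual :: "'a::complex_banach_algebra tensor_bidual \<Rightarrow> 'a cdual cdual" where
  "tensor_mult_bidual \<equiv> adjoint_map (adjoint_map tensor_mult)"

definition johnson_net ::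
  "'i set \<Rightarrow> ('i \<Rightarrow> 'i \<Rightarrow> bool) \<Rightarrow> ('i \<Rightarrow> 'a::complex_banach_algebra tensor_bidual) \<Rightarrow> bool" where
  "johnson_net I le m \<longleftrightarrow> directed_on I le \<and>
    (\<forall>i\<in>I. \<forall>a. bidual_left tensor_left a (m i) = bidual_right tensor_right (m i) a) \<and>
    (\<forall>a. ((\<lambda>i. bidual_right (*) (tensor_mult_bidual (m i)) a - bidual_embed a) \<longlongrightarrow> 0)
      (net_filter I le))"

definition johnson_pseudo_contractible :: "'a::complex_banach_algebra itself \<Rightarrow> bool" where
  "johnson_pseudo_contractible TYPE('a) \<longleftrightarrow>
    (\<exists>(I :: ('a tensor_bidual set \<times> 'a tensor_bidual) set) le (m :: _ \<Rightarrow> 'a tensor_bidual).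
      johnson_net I le m)"

definition bidual_bimodule_morphism ::
  "('a::complex_banach_algebra \<Rightarrow> 'a tensor_bidual) \<Rightarrow> bool" where
  "bidual_bimodule_morphism \<rho> \<longleftrightarrow> bounded_clinear \<rho> \<and>
    (\<forall>a b. \<rho> (a * b) = bidual_left tensor_left a (\<rho> b)) \<and>
    (\<forall>a b. \<rho> (a * b) = bidual_right tensor_right (\<rho> a) b)"

definition digamma_net ::
  "'i set \<Rightarrow> ('i \<Rightarrow> 'i \<Rightarrow> bool) \<Rightarrow> ('i \<Rightarrow> 'a::complex_banach_algebra \<Rightarrow> 'a tensor_bidual) \<Rightarrow> bool" where
  "digamma_net I le \<rho> \<longleftrightarrow> directed_on I le \<and>
    (\<forall>i\<in>I. bidual_bimodule_morphism (\<rho> i)) \<and>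
    (\<forall>a. ((\<lambda>i. tensor_mult_bidual (\<rho> i a) - bidual_embed a) \<longlongrightarrow> 0) (net_filter I le))"

definition property_digamma :: "'a::complex_banach_algebra itself \<Rightarrow> bool" where
  "property_digamma TYPE('a) \<longleftrightarrow>
    (\<exists>(I :: (('a \<Rightarrow> 'a tensor_bidual) set \<times> ('a \<Rightarrow> 'a tensor_bidual)) set) le
      (\<rho> :: _ \<Rightarrow> 'a \<Rightarrow> 'a tensor_bidual). digamma_net I le \<rho>)"

lemma johnson_pseudo_contractible_if_net:
  fixes m :: "'i \<Rightarrow> 'a::complex_banach_algebra tensor_bidual"
  assumes "johnson_net I le m"
  shows "johnson_pseudo_contractible TYPE('a)"
proof -
  have dir: "directed_on I le" using assms by (simp add: johnson_net_def)
  obtain J :: "('a tensor_bidual set \<times> 'a tensor_bidual) set" and le' m' where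
    J: "directed_on J le'" "m' ` J \<subseteq> m ` I" and
    eq: "filtermap m' (net_filter J le') = filtermap m (net_filter I le)"
    by (rule net_reindex[OF dir, of m])
  have "johnson_net J le' m'"
    unfolding johnson_net_def
  proof (intro conjI ballI allI)
    fix j a assume "j \<in> J"
    then obtain i where "i \<in> I" "m' j = m i" using J(2) by blast
    then show "bidual_left tensor_left a (m' j) = bidual_right tensor_right (m' j) a"
      using assms by (simp add: johnson_net_def)
  next
    fix a :: 'a
    have "((\<lambda>i. bidual_right (*) (tensor_mult_bidual (m i)) a - bidual_embed a) \<longlongrightarrow> 0) (net_filter I le)"
      using assms unfolding johnson_net_def by blast
    then show "((\<lambda>j. bidual_right (*) (tensor_mult_bidual (m' j)) a - bidual_embed a) \<longlongrightarrow> 0)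
        (net_filter J le')"
      by (rule tendsto_filtermap_eq[OF eq, of "\<lambda>x. bidual_right (*) (tensor_mult_bidual x) a - bidual_embed a"])
  qed (rule J)
  then show ?thesis unfolding johnson_pseudo_contractible_def by blast
qed

lemma property_digamma_if_net:
  fixes \<rho> :: "'i \<Rightarrow> 'a::complex_banach_algebra \<Rightarrow> 'a tensor_bidual"
  assumes "digamma_net I le \<rho>"
  shows "property_digamma TYPE('a)"
proof -
  have dir: "directed_on I le" using assms by (simp add: digamma_net_def)
  obtain J :: "(('a \<Rightarrow> 'a tensor_bidual) set \<times> ('a \<Rightarrow> 'a tensor_bidual)) set" and le' \<rho>' where
    J: "directed_on J le'" "\<rho>' ` J \<subseteq> \<rho> ` I" and
    eq: "filtermap \<rho>' (net_filter J le') = filtermap \<rho> (net_filter I le)"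
    by (rule net_reindex[OF dir, of \<rho>])
  have "digamma_net J le' \<rho>'"
    unfolding digamma_net_def
  proof (intro conjI ballI allI)
    fix j assume "j \<in> J"
    then obtain i where "i \<in> I" "\<rho>' j = \<rho> i" using J(2) by blast
    then show "bidual_bimodule_morphism (\<rho>' j)" using assms by (simp add: digamma_net_def)
  next
    fix a :: 'a
    have "((\<lambda>i. tensor_mult_bidual (\<rho> i a) - bidual_embed a) \<longlongrightarrow> 0) (net_filter I le)"
      using assms unfolding digamma_net_def by blast
    then show "((\<lambda>j. tensor_mult_bidual (\<rho>' j a) - bidual_embed a) \<longlongrightarrow> 0) (net_filter J le')"
      by (rule tendsto_filtermap_eq[OF eq, of "\<lambda>x. tensor_mult_bidual (x a) - bidual_embed a"])
  qed (rule J)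
  then show ?thesis unfolding property_digamma_def by blast
qed

end

theory Submission
  imports Defs
begin

text \<open>
  From a net \<open>m\<^sub>\<alpha>\<close> as in Johnson pseudo-contractibility one gets the bimodule morphisms
  \<open>a \<mapsto> a \<cdot> m\<^sub>\<alpha> = m\<^sub>\<alpha> \<cdot> a\<close>. Conversely, if \<open>\<rho>\<close> is a bimodule morphism and \<open>e\<close> is central, then
  \<open>\<rho>(e)\<close> commutes with \<open>A\<close>, and \<open>\<pi>\<^sup>*\<^sup>*(\<rho>(e)) \<cdot> a = \<pi>\<^sup>*\<^sup>*(\<rho>(e a))\<close>. Given finitely many \<open>a\<close>, one
  first chooses \<open>e\<close> with \<open>e a\<close> close to \<open>a\<close> and then \<open>\<rho>\<close> with \<open>\<pi>\<^sup>*\<^sup>*(\<rho>(e a))\<close> close to \<open>e a\<close>; the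
  resulting elements \<open>\<rho>(e)\<close> form a net indexed by the finite subsets of \<open>A\<close> and the tolerances.
\<close>

section \<open>Bounded linear maps on the projective tensor product\<close>

lemma bounded_clinear_add:
  assumes "bounded_clinear f" "bounded_clinear g"
  shows "bounded_clinear (\<lambda>x. f x + g x)"
  using assms by (simp add: bounded_clinear_def bounded_linear_add scaleC_add_right)

lemma bounded_clinear_scaleC: "bounded_clinear (\<lambda>x. c *\<^sub>C x)"
  by (simp add: bounded_clinear_def bounded_linear_scaleC scaleC_scaleC mult.commute)

text \<open>\<open>pnorm\<close> is an infimum over representations as sums of elementary tensors. A
  bound on elementary tensors adds up along each representation, passes to the infimum, and extends
  to the completion by density. This gives an explicit constant, which
  \<open>bounded_clinear\<close> leaves unspecified.\<close>

lemma norm_ptensor_map_le: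
  fixes f :: "('a::complex_normed_vector, 'b::complex_normed_vector) ptensor \<Rightarrow> 'c::complex_normed_vector"
  assumes f: "bounded_clinear f" and K: "0 \<le> K" "\<And>x y. norm (f (x \<otimes>\<^sub>p y)) \<le> K * (norm x * norm y)"
  shows "norm (f T) \<le> K * norm T"
proof -
  interpret f: bounded_linear f using f by (simp add: bounded_clinear_def)
  have sum: "norm (f (of_atensor (\<Sum>(x, y)\<leftarrow>xs. atensor x y))) \<le> K * (\<Sum>(x, y)\<leftarrow>xs. norm x * norm y)" for xs
  proof (induction xs)
    case (Cons p xs)
    obtain x y where p: "p = (x, y)" by force
    show ?case
      using Cons K(2)[of x y]
        norm_triangle_ineq[of "f (x \<otimes>\<^sub>p y)" "f (of_atensor (\<Sum>(x, y)\<leftarrow>xs. atensor x y))"]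
      by (simp add: p of_atensor_add f.add algebra_simps flip: ptensor_def)
  qed (simp add: of_atensor_zero f.zero)
  \<comment> \<open>Division by \<open>K\<close> brings the bound into the form
    \<open>pnorm_greatest\<close> accepts, so \<open>K = 0\<close> is split off; there a single
    representation suffices.\<close>
  have at: "norm (f (of_atensor t)) \<le> K * pnorm t" for t
  proof (cases "K = 0")
    case True
    obtain xs where "t = (\<Sum>(x, y)\<leftarrow>xs. atensor x y)" using atensor_repr by blast
    then show ?thesis using sum[of xs] True by simp
  next
    case False
    have "norm (f (of_atensor t)) / K \<le> pnorm t"
    proof (rule pnorm_greatest)
      fix xs assume "t = (\<Sum>(x, y)\<leftarrow>xs. atensor x y)"
      then show "norm (f (of_atensor t)) / K \<le> (\<Sum>(x, y)\<leftarrow>xs. norm x * norm y)"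
        using sum[of xs] K(1) False by (simp add: field_simps)
    qed
    then show ?thesis using K(1) False by (simp add: field_simps)
  qed
  obtain X where X: "pcauchy X" "T = abs_ptensor X" by (rule ptensor_cases)
  note lim = of_atensor_tendsto[OF X(1), folded X(2)]
  have "(\<lambda>n. K * norm (of_atensor (X n))) \<longlonglongrightarrow> K * norm T"
    by (intro tendsto_intros lim)
  moreover have "(\<lambda>n. norm (f (of_atensor (X n)))) \<longlonglongrightarrow> norm (f T)"
    by (intro tendsto_norm f.tendsto lim)
  ultimately show ?thesis
    using at by (auto intro: LIMSEQ_le simp: norm_of_atensor)
qed

text \<open>The dependence of the constant on \<open>a\<close> is what later makes a \<mapsto> a
  \<cdot> m bounded.\<close>

lemma norm_tensor_left_le: "norm (tensor_left a T) \<le> norm a * norm T"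
proof (rule norm_ptensor_map_le[OF bounded_clinear_tensor_left])
  fix b c :: 'a
  have "norm (tensor_left a (b \<otimes>\<^sub>p c)) \<le> norm (a * b) * norm c"
    unfolding tensor_left_ptensor by (simp add: ptensor_def norm_of_atensor pnorm_atensor_le)
  also have "\<dots> \<le> norm a * norm b * norm c"
    by (intro mult_right_mono norm_mult_ineq norm_ge_zero)
  finally show "norm (tensor_left a (b \<otimes>\<^sub>p c)) \<le> norm a * (norm b * norm c)" by (simp add: mult.assoc)
qed simp

text \<open>Bounded linear maps that agree on elementary tensors are equal. This and the following
  identities are equations between maps because \<open>adjoint_map\<close> takes the whole map as
  its argument.\<close>

lemma tensor_left_add: "tensor_left (a + b) = (\<lambda>T. tensor_left a T + tensor_left b T)"
proof (rule bounded_clinear_ptensor_eqI)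
  interpret bounded_bilinear "(\<otimes>\<^sub>p) :: 'a \<Rightarrow> 'a \<Rightarrow> _"
    using bounded_cbilinear_ptensor unfolding bounded_cbilinear_def by blast
  show "tensor_left (a + b) (x \<otimes>\<^sub>p y) = tensor_left a (x \<otimes>\<^sub>p y) + tensor_left b (x \<otimes>\<^sub>p y)" for x y
    by (simp add: tensor_left_ptensor distrib_right add_left)
qed (intro bounded_clinear_add bounded_clinear_tensor_left)+

lemma tensor_left_scaleC: "tensor_left (c *\<^sub>C a) = (\<lambda>T. c *\<^sub>C tensor_left a T)"
proof (rule bounded_clinear_ptensor_eqI)
  show "tensor_left (c *\<^sub>C a) (x \<otimes>\<^sub>p y) = c *\<^sub>C tensor_left a (x \<otimes>\<^sub>p y)" for x y
    using bounded_cbilinear_ptensor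
    by (auto simp: tensor_left_ptensor mult_scaleC_left bounded_cbilinear_def)
qed (intro bounded_clinear_compose[OF bounded_clinear_scaleC] bounded_clinear_tensor_left)+

lemma tensor_left_mult: "tensor_left (a * b) = (\<lambda>T. tensor_left a (tensor_left b T))"
  by (rule bounded_clinear_ptensor_eqI)
     (auto intro: bounded_clinear_compose bounded_clinear_tensor_left simp: tensor_left_ptensor mult.assoc)

lemma tensor_right_mult: "(\<lambda>T. tensor_right T (a * b)) = (\<lambda>T. tensor_right (tensor_right T a) b)"
  by (rule bounded_clinear_ptensor_eqI)
     (auto intro: bounded_clinear_compose[OF bounded_clinear_tensor_right bounded_clinear_tensor_right]
       bounded_clinear_tensor_right simp: tensor_right_ptensor mult.assoc)

lemma tensor_mult_right: "(\<lambda>T. tensor_mult (tensor_right T a)) = (\<lambda>T. tensor_mult T * a)"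
  by (rule bounded_clinear_ptensor_eqI)
     (auto intro: bounded_clinear_compose[OF bounded_clinear_tensor_mult bounded_clinear_tensor_right]
       bounded_clinear_compose[OF bounded_clinear_mult_right bounded_clinear_tensor_mult]
       simp: tensor_right_ptensor tensor_mult_ptensor mult.assoc)

section \<open>Bidual actions\<close>

lemma adjoint_map_compose:
  assumes "bounded_clinear S" "bounded_clinear T"
  shows "adjoint_map (\<lambda>x. S (T x)) = (\<lambda>f. adjoint_map T (adjoint_map S f))"
  by (intro ext cdual_eqI)
     (simp add: cdual_apply_adjoint_map assms bounded_clinear_compose[OF assms])

text \<open>One adjoint reverses the order of composition, a second restores it; hence identities
  between the actions on the tensor product carry over to the bidual.\<close>

lemma biadjoint_map_compose:
  assumes "bounded_clinear S" "bounded_clinear T"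
  shows "adjoint_map (adjoint_map (\<lambda>x. S (T x))) =
    (\<lambda>m. adjoint_map (adjoint_map S) (adjoint_map (adjoint_map T) m))"
  by (simp add: adjoint_map_compose assms bounded_clinear_adjoint_map)

lemma bidual_left_tensor_mult:
  "bidual_left tensor_left (a * b) m = bidual_left tensor_left a (bidual_left tensor_left b m)"
  by (simp add: bidual_left_adjoint tensor_left_mult biadjoint_map_compose bounded_clinear_tensor_left)

lemma bidual_right_tensor_mult:
  "bidual_right tensor_right m (a * b) = bidual_right tensor_right (bidual_right tensor_right m a) b"
  by (simp add: bidual_right_adjoint tensor_right_mult biadjoint_map_compose
      [OF bounded_clinear_tensor_right bounded_clinear_tensor_right])

text \<open>Both sides are biadjoints of the same map T \<mapsto> \<pi>(T \<cdot> a) = \<pi>(T) a.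
  Both implications rest on this identity.\<close>

lemma tensor_mult_bidual_right:
  "tensor_mult_bidual (bidual_right tensor_right m a) = bidual_right (*) (tensor_mult_bidual m) a"
  using biadjoint_map_compose[OF bounded_clinear_tensor_mult bounded_clinear_tensor_right[of a]]
    biadjoint_map_compose[OF bounded_clinear_mult_right[of a] bounded_clinear_tensor_mult]
  by (simp add: bidual_right_adjoint tensor_mult_right fun_eq_iff)

lemma bounded_linear_cdual_apply: "bounded_linear (cdual_apply f)"
  using bounded_clinear_cdual_apply unfolding bounded_clinear_def by blast

lemma bidual_embed_diff: "bidual_embed (x - y) = bidual_embed x - bidual_embed y"
proof (intro cdual_eqI)
  fix f :: "'a cdual"
  interpret bounded_linear "cdual_apply f"
    by (rule bounded_linear_cdual_apply)
  show "cdual_apply (bidual_embed (x - y)) f = cdual_apply (bidual_embed x - bidual_embed y) f"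
    by (simp add: cdual_apply_bidual_embed cdual_apply_simps diff)
qed

lemma norm_bidual_embed_le: "norm (bidual_embed x) \<le> norm x"
  by (rule norm_cdual_le) (simp_all add: cdual_apply_bidual_embed norm_cdual_apply_le mult.commute[of "norm x"])

lemma cdual_apply_bidual_left_tensor:
  "cdual_apply (bidual_left tensor_left a m) f = cdual_apply m (adjoint_map (tensor_left a) f)"
  by (simp add: bidual_left_adjoint cdual_apply_adjoint_map bounded_clinear_adjoint_map
      bounded_clinear_tensor_left)

text \<open>Linearity in \<open>a\<close> is lifted from \<open>tensor_left\<close> through two
  dualisations: first evaluated at a tensor, then at a functional.\<close>

lemma bounded_clinear_bidual_left_tensor: "bounded_clinear (\<lambda>a. bidual_left tensor_left a m)"
proof -
  interpret m: bounded_linear "cdual_apply m"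
    by (rule bounded_linear_cdual_apply)
  have m_scale: "cdual_apply m (c *\<^sub>C f) = c * cdual_apply m f" for c f
    using bounded_clinear_cdual_apply[of m] by (simp add: bounded_clinear_def scaleC_complex_def)
  have apply_add: "cdual_apply f (S + T) = cdual_apply f S + cdual_apply f T"
    and apply_scale: "cdual_apply f (c *\<^sub>C S) = c * cdual_apply f S"
    for f :: "('a, 'a) ptensor cdual" and S T c
    using bounded_clinear_cdual_apply[of f]
    by (auto simp: bounded_clinear_def scaleC_complex_def linear_add bounded_linear.linear)
  note adj = cdual_apply_adjoint_map[OF bounded_clinear_tensor_left]
  have "adjoint_map (tensor_left (a + b)) f = adjoint_map (tensor_left a) f + adjoint_map (tensor_left b) f"
    for a b :: 'a and f
    by (rule cdual_eqI) (simp only: adj cdual_apply_simps tensor_left_add[THEN fun_cong] apply_add)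
  then have add: "bidual_left tensor_left (a + b) m = bidual_left tensor_left a m + bidual_left tensor_left b m"
    for a b
    by (intro cdual_eqI) (simp add: cdual_apply_bidual_left_tensor cdual_apply_simps m.add)
  have "adjoint_map (tensor_left (c *\<^sub>C a)) f = c *\<^sub>C adjoint_map (tensor_left a) f" for c and a :: 'a and f
    by (rule cdual_eqI) (simp only: adj cdual_apply_simps tensor_left_scaleC[THEN fun_cong] apply_scale)
  then have scale: "bidual_left tensor_left (c *\<^sub>C a) m = c *\<^sub>C bidual_left tensor_left a m" for c a
    by (intro cdual_eqI) (simp add: cdual_apply_bidual_left_tensor cdual_apply_simps m_scale)
  \<comment> \<open>The factor \<open>norm a\<close> from \<open>norm_tensor_left_le\<close>
    survives each of the two dualisations unchanged.\<close>
  have "norm (bidual_left tensor_left a m) \<le> norm a * norm m" for a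
  proof (rule norm_cdual_le)
    fix f
    have "norm (adjoint_map (tensor_left a) f) \<le> norm a * norm f"
    proof (rule norm_cdual_le)
      fix T
      have "cmod (cdual_apply f (tensor_left a T)) \<le> norm f * norm (tensor_left a T)"
        by (rule norm_cdual_apply_le)
      also have "\<dots> \<le> norm f * (norm a * norm T)"
        by (intro mult_left_mono norm_tensor_left_le norm_ge_zero)
      finally show "cmod (cdual_apply (adjoint_map (tensor_left a) f) T) \<le> norm a * norm f * norm T"
        by (simp add: adj algebra_simps)
    qed simp
    then have "norm m * norm (adjoint_map (tensor_left a) f) \<le> norm m * (norm a * norm f)"
      by (intro mult_left_mono norm_ge_zero)
    with norm_cdual_apply_le[of m "adjoint_map (tensor_left a) f"]
    show "cmod (cdual_apply (bidual_left tensor_left a m) f) \<le> norm a * norm m * norm f"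
      by (simp add: cdual_apply_bidual_left_tensor algebra_simps)
  qed simp
  then have "bounded_linear (\<lambda>a. bidual_left tensor_left a m)"
    by (intro bounded_linear_intro[where K = "norm m"]) (auto simp: add scaleR_scaleC scale)
  then show ?thesis by (simp add: bounded_clinear_def scale)
qed

text \<open>The right module law follows from (a \<cdot> m) \<cdot> b = (m \<cdot> a) \<cdot> b = m
  \<cdot> (ab) = (ab) \<cdot> m.\<close>

lemma bidual_bimodule_morphism_if_commutes:
  assumes "\<And>a. bidual_left tensor_left a m = bidual_right tensor_right m a"
  shows "bidual_bimodule_morphism (\<lambda>a. bidual_left tensor_left a m)"
  unfolding bidual_bimodule_morphism_def
proof (intro conjI allI)
  fix a b
  show "bidual_left tensor_left (a * b) m = bidual_right tensor_right (bidual_left tensor_left a m) b"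
    by (simp add: assms bidual_right_tensor_mult)
qed (rule bounded_clinear_bidual_left_tensor bidual_left_tensor_mult)+

section \<open>Nets\<close>

lemma eventually_in_net_filter:
  assumes "directed_on I le"
  shows "\<forall>\<^sub>F i in net_filter I le. i \<in> I"
proof -
  have "I \<noteq> {}" using assms by (simp add: directed_on_def)
  then show ?thesis unfolding eventually_net_filter[OF assms] by blast
qed

lemma eventually_net_filter_ex:
  assumes "directed_on I le" "eventually P (net_filter I le)"
  shows "\<exists>i\<in>I. P i"
proof -
  obtain i where "i \<in> I" "\<And>j. j \<in> I \<Longrightarrow> le i j \<Longrightarrow> P j"
    using assms(2) unfolding eventually_net_filter[OF assms(1)] by blast
  moreover have "le i i" using assms(1) \<open>i \<in> I\<close> by (simp add: directed_on_def)
  ultimately show ?thesis by blast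
qed

text \<open>Reduces the construction of a net to a single element per finite set and tolerance;
  choice collects these elements into a net, and \<open>johnson_pseudo_contractible_if_net\<close>
  adapts its index type.\<close>

lemma johnson_pseudo_contractible_if_finite_approx:
  assumes "\<And>F \<epsilon>. finite F \<Longrightarrow> \<epsilon> > 0 \<Longrightarrow> \<exists>m :: 'a::complex_banach_algebra tensor_bidual.
    (\<forall>a. bidual_left tensor_left a m = bidual_right tensor_right m a) \<and>
    (\<forall>a\<in>F. norm (bidual_right (*) (tensor_mult_bidual m) a - bidual_embed a) < \<epsilon>)"
  shows "johnson_pseudo_contractible TYPE('a)"
proof -
  \<comment> \<open>The number \<open>n\<close> encodes the tolerance 1/(n+1), so larger indices
    mean better approximation.\<close>
  define J :: "('a set \<times> nat) set" where "J = {F. finite F} \<times> UNIV"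
  define le' :: "'a set \<times> nat \<Rightarrow> 'a set \<times> nat \<Rightarrow> bool"
    where "le' p q \<longleftrightarrow> fst p \<subseteq> fst q \<and> snd p \<le> snd q" for p q
  have "\<forall>p\<in>J. \<exists>m :: 'a tensor_bidual. (\<forall>a. bidual_left tensor_left a m = bidual_right tensor_right m a) \<and>
    (\<forall>a\<in>fst p. norm (bidual_right (*) (tensor_mult_bidual m) a - bidual_embed a) < inverse (Suc (snd p)))"
    by (intro ballI assms) (auto simp: J_def simp del: of_nat_Suc)
  then obtain m :: "'a set \<times> nat \<Rightarrow> 'a tensor_bidual" where
    comm: "\<And>p a. p \<in> J \<Longrightarrow> bidual_left tensor_left a (m p) = bidual_right tensor_right (m p) a" and
    approx: "\<And>p a. p \<in> J \<Longrightarrow> a \<in> fst p \<Longrightarrow>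
      norm (bidual_right (*) (tensor_mult_bidual (m p)) a - bidual_embed a) < inverse (Suc (snd p))"
    unfolding bchoice_iff by blast
  have dir: "directed_on J le'"
    unfolding directed_on_def
  proof (intro conjI ballI impI)
    fix p q assume "p \<in> J" "q \<in> J"
    then show "\<exists>r\<in>J. le' p r \<and> le' q r"
      by (intro bexI[of _ "(fst p \<union> fst q, max (snd p) (snd q))"]) (auto simp: J_def le'_def)
  qed (auto simp: J_def le'_def)
  have "johnson_net J le' m"
    unfolding johnson_net_def
  proof (intro conjI ballI allI dir comm)
    fix a :: 'a
    show "((\<lambda>p. bidual_right (*) (tensor_mult_bidual (m p)) a - bidual_embed a) \<longlongrightarrow> 0) (net_filter J le')"
    proof (rule tendstoI)
      fix \<epsilon> :: real assume "\<epsilon> > 0"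
      then obtain n where n: "inverse (real (Suc n)) < \<epsilon>" using reals_Archimedean by blast
      \<comment> \<open>Every index beyond \<open>({a}, n)\<close> has \<open>a\<close> in its
        finite set and a tolerance of at most 1/(n+1).\<close>
      have "norm (bidual_right (*) (tensor_mult_bidual (m q)) a - bidual_embed a) < \<epsilon>"
        if q: "q \<in> J" "le' ({a}, n) q" for q
      proof -
        have "inverse (real (Suc (snd q))) \<le> inverse (real (Suc n))"
          using q(2) by (intro le_imp_inverse_le) (auto simp: le'_def)
        moreover have "a \<in> fst q" using q(2) by (simp add: le'_def)
        ultimately show ?thesis using approx[OF q(1), of a] n by linarith
      qed
      moreover have "({a}, n) \<in> J" by (simp add: J_def)
      ultimately show "\<forall>\<^sub>F p in net_filter J le'.
          dist (bidual_right (*) (tensor_mult_bidual (m p)) a - bidual_embed a) 0 < \<epsilon>"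
        unfolding eventually_net_filter[OF dir] dist_norm diff_zero by blast
    qed
  qed
  then show ?thesis by (rule johnson_pseudo_contractible_if_net)
qed

section \<open>The two implications\<close>

lemma property_digamma_if_johnson_pseudo_contractible:
  assumes "johnson_pseudo_contractible TYPE('a::complex_banach_algebra)"
  shows "property_digamma TYPE('a)"
proof -
  obtain J :: "('a tensor_bidual set \<times> 'a tensor_bidual) set" and le'
    and m :: "_ \<Rightarrow> 'a tensor_bidual" where "johnson_net J le' m"
    using assms unfolding johnson_pseudo_contractible_def by blast
  then have dir: "directed_on J le'"
    and comm: "\<And>j a. j \<in> J \<Longrightarrow> bidual_left tensor_left a (m j) = bidual_right tensor_right (m j) a"
    and lim: "\<And>a. ((\<lambda>j. bidual_right (*) (tensor_mult_bidual (m j)) a - bidual_embed a) \<longlongrightarrow> 0)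
      (net_filter J le')"
    unfolding johnson_net_def by blast+
  have "digamma_net J le' (\<lambda>j a. bidual_left tensor_left a (m j))"
    unfolding digamma_net_def
  proof (intro conjI ballI allI dir)
    fix a :: 'a
    \<comment> \<open>The elements \<open>m j\<close> are known to commute with the algebra only for
      \<open>j\<close> in \<open>J\<close>, so the two nets are compared eventually.\<close>
    have "eventually (\<lambda>j. j \<in> J) (net_filter J le')"
      by (rule eventually_in_net_filter[OF dir])
    then have "\<forall>\<^sub>F j in net_filter J le'.
        bidual_right (*) (tensor_mult_bidual (m j)) a - bidual_embed a =
        tensor_mult_bidual (bidual_left tensor_left a (m j)) - bidual_embed a"
      by eventually_elim (simp add: comm tensor_mult_bidual_right)
    with lim show "((\<lambda>j. tensor_mult_bidual (bidual_left tensor_left a (m j)) - bidual_embed a) \<longlongrightarrow> 0)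
        (net_filter J le')"
      by (rule Lim_transform_eventually)
  qed (intro bidual_bimodule_morphism_if_commutes comm)
  then show ?thesis by (rule property_digamma_if_net)
qed

theorem proposition3p1:
  fixes I :: "'i set" and le :: "'i \<Rightarrow> 'i \<Rightarrow> bool" and e :: "'i \<Rightarrow> 'a::complex_banach_algebra"
  assumes "central_approximate_identity I le e"
  shows "johnson_pseudo_contractible TYPE('a) \<longleftrightarrow> property_digamma TYPE('a)"
proof
  assume "johnson_pseudo_contractible TYPE('a)"
  then show "property_digamma TYPE('a)" by (rule property_digamma_if_johnson_pseudo_contractible)
next
  assume "property_digamma TYPE('a)"
  then obtain J :: "(('a \<Rightarrow> 'a tensor_bidual) set \<times> ('a \<Rightarrow> 'a tensor_bidual)) set" and le'
    and \<rho> :: "_ \<Rightarrow> 'a \<Rightarrow> 'a tensor_bidual" where "digamma_net J le' \<rho>"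
    unfolding property_digamma_def by blast
  then have dir': "directed_on J le'"
    and left: "\<And>j a b. j \<in> J \<Longrightarrow> \<rho> j (a * b) = bidual_left tensor_left a (\<rho> j b)"
    and right: "\<And>j a b. j \<in> J \<Longrightarrow> \<rho> j (a * b) = bidual_right tensor_right (\<rho> j a) b"
    and lim': "\<And>a. ((\<lambda>j. tensor_mult_bidual (\<rho> j a) - bidual_embed a) \<longlongrightarrow> 0) (net_filter J le')"
    unfolding digamma_net_def bidual_bimodule_morphism_def by blast+
  have dir: "directed_on I le"
    and central: "\<And>i a. i \<in> I \<Longrightarrow> a * e i = e i * a"
    and lim: "\<And>a. ((\<lambda>i. e i * a) \<longlongrightarrow> a) (net_filter I le)"
    using assms unfolding central_approximate_identity_def by blast+
  show "johnson_pseudo_contractible TYPE('a)"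
  proof (rule johnson_pseudo_contractible_if_finite_approx)
    fix F :: "'a set" and \<epsilon> :: real
    assume F: "finite F" and \<epsilon>: "\<epsilon> > 0"
    \<comment> \<open>The index \<open>i\<close> is fixed first: the \<rho>-net converges only
      pointwise, and with \<open>i\<close> fixed it has to be controlled just at the finitely many
      points \<open>e i * a\<close>.\<close>
    have "\<forall>\<^sub>F i in net_filter I le. \<forall>a\<in>F. dist (e i * a) a < \<epsilon> / 2"
      using \<epsilon> by (intro eventually_ball_finite F ballI tendstoD[OF lim]) simp
    then obtain i where i: "i \<in> I" "\<And>a. a \<in> F \<Longrightarrow> norm (e i * a - a) < \<epsilon> / 2"
      using eventually_net_filter_ex[OF dir] unfolding dist_norm by blast
    have "\<forall>\<^sub>F j in net_filter J le'. \<forall>a\<in>F.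
        dist (tensor_mult_bidual (\<rho> j (e i * a)) - bidual_embed (e i * a)) 0 < \<epsilon> / 2"
      using \<epsilon> by (intro eventually_ball_finite F ballI tendstoD[OF lim']) simp
    then obtain j where j: "j \<in> J" "\<And>a. a \<in> F \<Longrightarrow>
        norm (tensor_mult_bidual (\<rho> j (e i * a)) - bidual_embed (e i * a)) < \<epsilon> / 2"
      using eventually_net_filter_ex[OF dir'] unfolding dist_norm diff_zero by blast
    \<comment> \<open>By centrality, a \<cdot> \<rho>(e) = \<rho>(ae) = \<rho>(ea) = \<rho>(e)
      \<cdot> a.\<close>
    have "bidual_left tensor_left a (\<rho> j (e i)) = bidual_right tensor_right (\<rho> j (e i)) a" for a
      using left[OF j(1), of a "e i"] right[OF j(1), of "e i" a] central[OF i(1), of a] by simp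
    moreover have "norm (bidual_right (*) (tensor_mult_bidual (\<rho> j (e i))) a - bidual_embed a) < \<epsilon>"
      if a: "a \<in> F" for a
    proof -
      \<comment> \<open>The action of \<open>a\<close> moves inside the biadjoint and then inside
        \<rho>, producing \<open>\<rho> j (e i * a)\<close>; inserting
        \<open>bidual_embed (e i * a)\<close> separates the errors of the two nets.\<close>
      have "bidual_right (*) (tensor_mult_bidual (\<rho> j (e i))) a - bidual_embed a =
          (tensor_mult_bidual (\<rho> j (e i * a)) - bidual_embed (e i * a)) + bidual_embed (e i * a - a)"
        by (simp add: right[OF j(1)] tensor_mult_bidual_right bidual_embed_diff)
      also have "norm \<dots> < \<epsilon> / 2 + \<epsilon> / 2"
        by (intro norm_add_less j(2) a le_less_trans[OF norm_bidual_embed_le] i(2))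
      finally show ?thesis by simp
    qed
    ultimately show "\<exists>m :: 'a tensor_bidual.
        (\<forall>a. bidual_left tensor_left a m = bidual_right tensor_right m a) \<and>
        (\<forall>a\<in>F. norm (bidual_right (*) (tensor_mult_bidual m) a - bidual_embed a) < \<epsilon>)"
      by blast
  qed
qed

end
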